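(* There exists a randomized algorithm for asymmetric streaming longest common substring that computes the length of the longest common substring of the two input strings with memory $O(1)$ and runtime $\tilde O(nm)$, where $n$ and $m$ are the lengths of the two strings; the algorithm succeeds with probability at least $1-n^{-5}$.
   Context: Asymmetric longest common substring (LCS): a string $A$ is available via value queries (query an index $i$, receive the $i$-th character of $A$), and another string $B$ arrives as a stream of characters. The goal is to find the longest (contiguous) substring of $A$ that also appears as a (contiguous) substring of $B$. Memory is measured in machine words (each holding an index or a number polynomial in the input length), not counting read-only access to $A$. $\tilde O$ hides polylogarithmic factors. *)

theory Defs
  imports "HOL-Probability.Probability" "HOL-Library.Sublist"
begin

definition lcs_len :: "nat list \<Rightarrow> nat list \<Rightarrow> nat" where
  "lcs_len A B = Max {length s | s. sublist s A \<and> sublist s B}"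

text \<open>A randomized word-RAM with a constant number of registers (words), value-query
  access to A and one-pass stream access to B.  Registers are indexed by nat; since a
  program is a fixed finite list of instructions, it only ever touches a constant
  number of registers (O(1) memory).  Word size: every register value must stay below
  (n+m+2)^c for a constant c (checked in the theorem).\<close>
datatype instr =
    Const nat nat
  | Add nat nat nat
  | Sub nat nat nat        \<comment> \<open>R[d] := R[a] - R[b] (truncated)\<close>
  | Mul nat nat nat
  | Div nat nat nat
  | Mod nat nat nat
  | Jlt nat nat nat
  | Jmp nat
  | LenA nat
  | QueryA nat nat
  | ReadB nat nat
  | Rand nat nat
  | Halt nat

record cfg =
  pc :: nat
  regs :: "nat \<Rightarrow> nat"
  spos :: nat
  result :: "nat option"

definition init_cfg :: cfg where
  "init_cfg = \<lparr>pc = 0, regs = (\<lambda>_. 0), spos = 0, result = None\<rparr>"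

definition setr :: "cfg \<Rightarrow> nat \<Rightarrow> nat \<Rightarrow> cfg" where
  "setr s d v = s\<lparr>regs := (regs s)(d := v), pc := Suc (pc s)\<rparr>"

fun exec :: "instr \<Rightarrow> nat list \<Rightarrow> nat list \<Rightarrow> cfg \<Rightarrow> cfg pmf" where
  "exec (Const d v) A B s = return_pmf (setr s d v)"
| "exec (Add d a b) A B s = return_pmf (setr s d (regs s a + regs s b))"
| "exec (Sub d a b) A B s = return_pmf (setr s d (regs s a - regs s b))"
| "exec (Mul d a b) A B s = return_pmf (setr s d (regs s a * regs s b))"
| "exec (Div d a b) A B s = return_pmf (setr s d (regs s a div regs s b))"
| "exec (Mod d a b) A B s = return_pmf (setr s d (regs s a mod regs s b))"
| "exec (Jlt a b l) A B s =
     return_pmf (s\<lparr>pc := (if regs s a < regs s b then l else Suc (pc s))\<rparr>)"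
| "exec (Jmp l) A B s = return_pmf (s\<lparr>pc := l\<rparr>)"
| "exec (LenA d) A B s = return_pmf (setr s d (length A))"
| "exec (QueryA d i) A B s =
     return_pmf (setr s d (if regs s i < length A then A ! regs s i else 0))"
| "exec (ReadB d f) A B s =
     return_pmf (if spos s < length B
       then s\<lparr>regs := ((regs s)(d := B ! spos s))(f := 1), spos := Suc (spos s),
              pc := Suc (pc s)\<rparr>
       else s\<lparr>regs := (regs s)(f := 0), pc := Suc (pc s)\<rparr>)"
| "exec (Rand d r) A B s =
     (if regs s r = 0 then return_pmf (setr s d 0)
      else map_pmf (setr s d) (pmf_of_set {0..<regs s r}))"
| "exec (Halt r) A B s = return_pmf (s\<lparr>result := Some (regs s r)\<rparr>)"

text \<open>One step: halted configurations stay put; a program counter outside the program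
  leaves the machine stuck (not halted).\<close>
definition step :: "instr list \<Rightarrow> nat list \<Rightarrow> nat list \<Rightarrow> cfg \<Rightarrow> cfg pmf" where
  "step P A B s =
     (if result s \<noteq> None \<or> pc s \<ge> length P then return_pmf s
      else exec (P ! pc s) A B s)"

fun run :: "instr list \<Rightarrow> nat list \<Rightarrow> nat list \<Rightarrow> nat \<Rightarrow> cfg pmf" where
  "run P A B 0 = return_pmf init_cfg"
| "run P A B (Suc k) = bind_pmf (run P A B k) (step P A B)"

end

theory Submission
  imports Defs
begin

text \<open>
  A deterministic algorithm suffices. It remembers the longest suffix of the stream read so far that
  occurs in \<^term>\<open>A\<close>, as an occurrence in \<^term>\<open>A\<close>. A new character appended to this suffix gives a
  pattern, and the new longest suffix is found by extending a match of the reversed pattern at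
  positions of the reversed \<^term>\<open>A\<close>, in time linear in the length of \<^term>\<open>A\<close>.

  After a match of length \<open>q\<close> at \<open>p\<close>, the shortest period \<open>t\<close> of the matched prefix is recomputed in
  time \<open>O(q)\<close>, by looking for a maximal rotation with two pointers; only a period with \<open>4 t \<le> q\<close>
  matters. Without one, no longer match starts before \<open>p + q div 4 + 1\<close>. With one, let \<open>r\<close> be the end
  of the \<open>t\<close>-periodic run of the text from \<open>p\<close>. A longer match can start before \<open>r - q div 2\<close> only at
  \<open>r - q\<close>, and only if \<open>t\<close> divides the jump from \<open>p\<close> to there. This jump may be much shorter than \<open>q\<close>,
  but if the same happens again at \<open>r - q\<close>, then by the theorem of Fine and Wilf the match there is
  more than twice as long, so that the costs of consecutive short jumps form a geometric series.
\<close>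

section \<open>Structured programs for the machine\<close>

text \<open>The second component is the number of stream characters already read. The program
  counter is left out, since the structured programs below have none.\<close>

type_synonym store = "(nat \<Rightarrow> nat) \<times> nat"

fun basic :: "instr \<Rightarrow> bool" where
  "basic (Jlt _ _ _) = False"
| "basic (Jmp _) = False"
| "basic (Rand _ _) = False"
| "basic (Halt _) = False"
| "basic _ = True"

fun effect :: "nat list \<Rightarrow> nat list \<Rightarrow> instr \<Rightarrow> store \<Rightarrow> store" where
  "effect A B (Const d v) (R, p) = (R(d := v), p)"
| "effect A B (Add d a b) (R, p) = (R(d := R a + R b), p)"
| "effect A B (Sub d a b) (R, p) = (R(d := R a - R b), p)"
| "effect A B (Mul d a b) (R, p) = (R(d := R a * R b), p)"
| "effect A B (Div d a b) (R, p) = (R(d := R a div R b), p)"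
| "effect A B (Mod d a b) (R, p) = (R(d := R a mod R b), p)"
| "effect A B (LenA d) (R, p) = (R(d := length A), p)"
| "effect A B (QueryA d i) (R, p) = (R(d := (if R i < length A then A ! R i else 0)), p)"
| "effect A B (ReadB d f) (R, p) =
     (if p < length B then (R(d := B ! p, f := 1), Suc p) else (R(f := 0), p))"
| "effect A B _ s = s"

section \<open>Structured commands with exact step counts, and their compilation\<close>

datatype com = SKIP | Bas instr | Seq com com (infixr ";;" 60)
  | IfLess nat nat com com | WhileLess nat nat com

text \<open>The times are exactly those of the compiled code. As the second branch of a conditional
  is placed first, a true test costs one jump, while a false one also pays for jumping over the
  other branch. A round of a loop pays for its test and the jump back, and leaving pays for the
  failed test and the exit jump.\<close>

inductive big :: "nat list \<Rightarrow> nat list \<Rightarrow> com \<Rightarrow> store \<Rightarrow> nat \<Rightarrow> store \<Rightarrow> bool"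
  for A B where
  Skip: "big A B SKIP s 0 s"
| Bas: "big A B (Bas i) s 1 (effect A B i s)"
| Seq: "big A B c1 s t s' \<Longrightarrow> big A B c2 s' t' s'' \<Longrightarrow> big A B (c1 ;; c2) s (t + t') s''"
| IfTrue: "fst s a < fst s b \<Longrightarrow> big A B c1 s t s' \<Longrightarrow> big A B (IfLess a b c1 c2) s (t + 1) s'"
| IfFalse: "\<not> fst s a < fst s b \<Longrightarrow> big A B c2 s t s' \<Longrightarrow> big A B (IfLess a b c1 c2) s (t + 2) s'"
| WhileTrue: "fst s a < fst s b \<Longrightarrow> big A B c s t s' \<Longrightarrow> big A B (WhileLess a b c) s' t' s'' \<Longrightarrow>
    big A B (WhileLess a b c) s (t + t' + 2) s''"
| WhileFalse: "\<not> fst s a < fst s b \<Longrightarrow> big A B (WhileLess a b c) s 2 s"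

inductive_cases big_SkipE: "big A B SKIP s t s'"
inductive_cases big_BasE: "big A B (Bas i) s t s'"
inductive_cases big_SeqE: "big A B (c1 ;; c2) s t s'"
inductive_cases big_IfE: "big A B (IfLess a b c1 c2) s t s'"

text \<open>Jump targets are absolute, so the address at which the code will be placed is a
  parameter.\<close>

fun compile :: "nat \<Rightarrow> com \<Rightarrow> instr list" where
  "compile l SKIP = []"
| "compile l (Bas i) = [i]"
| "compile l (c1 ;; c2) = (let P1 = compile l c1 in P1 @ compile (l + length P1) c2)"
| "compile l (IfLess a b c1 c2) =
     (let P2 = compile (l + 1) c2; P1 = compile (l + 2 + length P2) c1 in
      Jlt a b (l + 2 + length P2) # P2 @ Jmp (l + 2 + length P2 + length P1) # P1)"
| "compile l (WhileLess a b c) =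
     (let P = compile (l + 2) c in Jlt a b (l + 2) # Jmp (l + 3 + length P) # P @ [Jmp l])"

text \<open>On \<open>Rand\<close> the value is a mere default; \<open>exec_det\<close> excludes
  that instruction.\<close>

fun det_exec :: "instr \<Rightarrow> nat list \<Rightarrow> nat list \<Rightarrow> cfg \<Rightarrow> cfg" where
  "det_exec (Jlt a b l) A B s = s\<lparr>pc := (if regs s a < regs s b then l else Suc (pc s))\<rparr>"
| "det_exec (Jmp l) A B s = s\<lparr>pc := l\<rparr>"
| "det_exec (Halt r) A B s = s\<lparr>result := Some (regs s r)\<rparr>"
| "det_exec i A B s = (case effect A B i (regs s, spos s) of (R, p) \<Rightarrow>
     s\<lparr>regs := R, spos := p, pc := Suc (pc s)\<rparr>)"

definition dstep :: "instr list \<Rightarrow> nat list \<Rightarrow> nat list \<Rightarrow> cfg \<Rightarrow> cfg" where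
  "dstep P A B s = (if result s \<noteq> None \<or> pc s \<ge> length P then s else det_exec (P ! pc s) A B s)"

fun is_rand :: "instr \<Rightarrow> bool" where
  "is_rand (Rand _ _) = True"
| "is_rand _ = False"

lemma exec_det: "\<not> is_rand i \<Longrightarrow> exec i A B s = return_pmf (det_exec i A B s)"
  by (cases i) (auto simp: setr_def)

lemma step_dstep:
  assumes "\<forall>i \<in> set P. \<not> is_rand i"
  shows "step P A B s = return_pmf (dstep P A B s)"
  using assms by (auto simp: step_def dstep_def exec_det)

lemma run_dstep:
  assumes "\<forall>i \<in> set P. \<not> is_rand i"
  shows "run P A B k = return_pmf ((dstep P A B ^^ k) init_cfg)"
  by (induction k) (auto simp: step_dstep[OF assms] bind_return_pmf)

definition conf :: "nat \<Rightarrow> store \<Rightarrow> cfg" where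
  "conf l s = \<lparr>pc = l, regs = fst s, spos = snd s, result = None\<rparr>"

lemma dstep_conf:
  "l < length P \<Longrightarrow> dstep P A B (conf l s) = det_exec (P ! l) A B (conf l s)"
  by (simp add: dstep_def conf_def)

lemma det_exec_basic: "basic i \<Longrightarrow> det_exec i A B (conf l s) = conf (Suc l) (effect A B i s)"
  by (cases i; cases s) (auto simp: conf_def)

lemma det_exec_Jlt: "det_exec (Jlt a b k) A B (conf l s) = conf (if fst s a < fst s b then k else Suc l) s"
  by (simp add: conf_def)

lemma det_exec_Jmp: "det_exec (Jmp k) A B (conf l s) = conf k s"
  by (simp add: conf_def)

fun basics :: "com \<Rightarrow> instr set" where
  "basics SKIP = {}"
| "basics (Bas i) = {i}"
| "basics (c1 ;; c2) = basics c1 \<union> basics c2"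
| "basics (IfLess a b c1 c2) = basics c1 \<union> basics c2"
| "basics (WhileLess a b c) = basics c"

lemma funpow_trans: "(f ^^ m) x = y \<Longrightarrow> (f ^^ n) y = z \<Longrightarrow> (f ^^ (m + n)) x = z"
  by (metis add.commute comp_apply funpow_add)

text \<open>The surrounding code \<open>pre\<close> and \<open>post\<close> is arbitrary because the
  induction has to place each subprogram among its siblings and the jumps generated around
  it.\<close>

lemma comp_correct:
  assumes "big A B c s t s'" and "\<forall>i \<in> basics c. basic i"
    and "P = pre @ compile (length pre) c @ post"
  shows "(dstep P A B ^^ t) (conf (length pre) s) = conf (length pre + length (compile (length pre) c)) s'"
  using assms
proof (induction arbitrary: pre post rule: big.induct)
  case (Skip s)
  then show ?case by simp
next
  case (Bas i s)
  then show ?case by (simp add: dstep_conf det_exec_basic)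
next
  case (Seq c1 s t s' c2 t' s'')
  let ?P1 = "compile (length pre) c1"
  let ?P2 = "compile (length (pre @ ?P1)) c2"
  have 1: "(dstep P A B ^^ t) (conf (length pre) s) = conf (length pre + length ?P1) s'"
    by (rule Seq.IH(1)[of _ "?P2 @ post"]) (use Seq.prems in \<open>simp_all add: Let_def\<close>)
  have 2: "(dstep P A B ^^ t') (conf (length (pre @ ?P1)) s')
      = conf (length (pre @ ?P1) + length ?P2) s''"
    by (rule Seq.IH(2)[of _ post]) (use Seq.prems in \<open>simp_all add: Let_def\<close>)
  show ?case using funpow_trans[OF 1] 2 by (simp add: Let_def add.assoc)
next
  case (IfTrue s a b c1 t s' c2)
  let ?l = "length pre"
  let ?P2 = "compile (?l + 1) c2"
  let ?P1 = "compile (?l + 2 + length ?P2) c1"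
  let ?pre = "pre @ Jlt a b (?l + 2 + length ?P2) # ?P2 @ [Jmp (?l + 2 + length ?P2 + length ?P1)]"
  have l: "length ?pre = ?l + 2 + length ?P2" by simp
  have 1: "(dstep P A B ^^ 1) (conf ?l s) = conf (?l + 2 + length ?P2) s"
    using IfTrue.hyps IfTrue.prems by (simp add: dstep_conf det_exec_Jlt Let_def del: det_exec.simps)
  have 2: "(dstep P A B ^^ t) (conf (length ?pre) s) = conf (length ?pre + length (compile (length ?pre) c1)) s'"
    by (rule IfTrue.IH[of _ post]) (use IfTrue.prems in \<open>simp_all add: Let_def\<close>)
  show ?case using funpow_trans[OF 1 2[unfolded l]] by (simp add: Let_def add.commute add.assoc)
next
  case (IfFalse s a b c2 t s' c1)
  let ?l = "length pre"
  let ?P2 = "compile (?l + 1) c2"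
  let ?P1 = "compile (?l + 2 + length ?P2) c1"
  let ?pre = "pre @ [Jlt a b (?l + 2 + length ?P2)]"
  have l: "length ?pre = ?l + 1" by simp
  have 1: "(dstep P A B ^^ 1) (conf ?l s) = conf (?l + 1) s"
    using IfFalse.hyps IfFalse.prems by (simp add: dstep_conf det_exec_Jlt Let_def del: det_exec.simps)
  have 2: "(dstep P A B ^^ t) (conf (length ?pre) s) = conf (length ?pre + length (compile (length ?pre) c2)) s'"
    by (rule IfFalse.IH[of _ "Jmp (?l + 2 + length ?P2 + length ?P1) # ?P1 @ post"])
      (use IfFalse.prems in \<open>simp_all add: Let_def\<close>)
  have "P ! (?l + 1 + length ?P2) = Jmp (?l + 2 + length ?P2 + length ?P1)"
    using IfFalse.prems by (simp add: Let_def nth_append)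
  then have 3: "(dstep P A B ^^ 1) (conf (?l + 1 + length ?P2) s') = conf (?l + 2 + length ?P2 + length ?P1) s'"
    using IfFalse.prems by (simp add: dstep_conf det_exec_Jmp Let_def del: det_exec.simps)
  show ?case using funpow_trans[OF funpow_trans[OF 1 2[unfolded l]] 3]
    by (simp add: Let_def add.commute add.assoc)
next
  case (WhileTrue s a b c t s' t' s'')
  let ?l = "length pre"
  let ?P = "compile (?l + 2) c"
  let ?pre = "pre @ [Jlt a b (?l + 2), Jmp (?l + 3 + length ?P)]"
  have l: "length ?pre = ?l + 2" by simp
  have 1: "(dstep P A B ^^ 1) (conf ?l s) = conf (?l + 2) s"
    using WhileTrue.hyps WhileTrue.prems by (simp add: dstep_conf det_exec_Jlt Let_def del: det_exec.simps)
  have 2: "(dstep P A B ^^ t) (conf (length ?pre) s) = conf (length ?pre + length (compile (length ?pre) c)) s'"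
    by (rule WhileTrue.IH(1)[of _ "[Jmp ?l] @ post"])
      (use WhileTrue.prems in \<open>simp_all add: Let_def\<close>)
  have "P ! (?l + 2 + length ?P) = Jmp ?l"
    using WhileTrue.prems by (simp add: Let_def nth_append)
  then have 3: "(dstep P A B ^^ 1) (conf (?l + 2 + length ?P) s') = conf ?l s'"
    using WhileTrue.prems by (simp add: dstep_conf det_exec_Jmp Let_def del: det_exec.simps)
  have 4: "(dstep P A B ^^ t') (conf ?l s') = conf (?l + length (compile ?l (WhileLess a b c))) s''"
    by (rule WhileTrue.IH(2)) (use WhileTrue.prems in simp_all)
  have e: "1 + t + 1 + t' = t + t' + 2" by simp
  show ?case using funpow_trans[OF funpow_trans[OF funpow_trans[OF 1 2[unfolded l]] 3] 4] unfolding e .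
next
  case (WhileFalse s a b c)
  let ?l = "length pre"
  let ?P = "compile (?l + 2) c"
  have 1: "(dstep P A B ^^ 1) (conf ?l s) = conf (?l + 1) s"
    using WhileFalse by (simp add: dstep_conf det_exec_Jlt Let_def del: det_exec.simps)
  have "P ! (?l + 1) = Jmp (?l + 3 + length ?P)"
    using WhileFalse.prems by (simp add: Let_def nth_append)
  then have 2: "(dstep P A B ^^ 1) (conf (?l + 1) s) = conf (?l + 3 + length ?P) s"
    using WhileFalse.prems by (simp add: dstep_conf det_exec_Jmp Let_def del: det_exec.simps)
  show ?case using funpow_trans[OF 1 2] by (simp add: Let_def eval_nat_numeral)
qed

lemma comp_set: "i \<in> set (compile l c) \<Longrightarrow> i \<in> basics c \<or> (\<exists>a b k. i = Jlt a b k) \<or> (\<exists>k. i = Jmp k)"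
  by (induction c arbitrary: l) (auto simp: Let_def)

section \<open>A weakest-precondition calculus whose postconditions see the step count\<close>

definition wp :: "nat list \<Rightarrow> nat list \<Rightarrow> com \<Rightarrow> store \<Rightarrow> (nat \<Rightarrow> store \<Rightarrow> bool) \<Rightarrow> bool" where
  "wp A B c s Q \<longleftrightarrow> (\<exists>t s'. big A B c s t s' \<and> Q t s')"

lemma wp_Skip [simp]: "wp A B SKIP s Q = Q 0 s"
  unfolding wp_def by (blast intro: big.Skip elim: big_SkipE)

lemma wp_Bas [simp]: "wp A B (Bas i) s Q = Q 1 (effect A B i s)"
proof
  assume "wp A B (Bas i) s Q"
  then show "Q 1 (effect A B i s)" unfolding wp_def by (elim exE conjE big_BasE) simp
next
  assume "Q 1 (effect A B i s)"
  then show "wp A B (Bas i) s Q" unfolding wp_def using big.Bas by blast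
qed

lemma wp_Seq [simp]:
  "wp A B (c1 ;; c2) s Q = wp A B c1 s (\<lambda>t s'. wp A B c2 s' (\<lambda>t'. Q (t + t')))"
  unfolding wp_def by (blast intro: big.Seq elim: big_SeqE)

lemma wp_If [simp]:
  "wp A B (IfLess a b c1 c2) s Q = (if fst s a < fst s b then wp A B c1 s (\<lambda>t. Q (t + 1))
     else wp A B c2 s (\<lambda>t. Q (t + 2)))" (is "?l = ?r")
proof
  assume ?l
  then obtain t s' where "big A B (IfLess a b c1 c2) s t s'" "Q t s'" unfolding wp_def by blast
  then show ?r unfolding wp_def by (elim big_IfE) (simp_all del: split_paired_Ex, blast+)
next
  assume r: ?r
  show ?l
  proof (cases "fst s a < fst s b")
    case True
    with r obtain t s' where "big A B c1 s t s'" "Q (t + 1) s'" unfolding wp_def by auto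
    with big.IfTrue[OF True] show ?thesis unfolding wp_def by blast
  next
    case False
    with r obtain t s' where "big A B c2 s t s'" "Q (t + 2) s'" unfolding wp_def by auto
    with big.IfFalse[OF False] show ?thesis unfolding wp_def by blast
  qed
qed

lemma wp_mono: "wp A B c s Q \<Longrightarrow> (\<And>t s'. Q t s' \<Longrightarrow> Q' t s') \<Longrightarrow> wp A B c s Q'"
  unfolding wp_def by blast

text \<open>The potential \<^term>\<open>f\<close> pays for the steps of the loop, including the two jumps of every round;
  hence it also proves termination.\<close>
lemma wp_While:
  assumes "I s"
    and "\<And>s. I s \<Longrightarrow> fst s a < fst s b \<Longrightarrow> wp A B c s (\<lambda>t s'. I s' \<and> t + f s' + 2 \<le> f s)"
  shows "wp A B (WhileLess a b c) s (\<lambda>t s'. I s' \<and> \<not> fst s' a < fst s' b \<and> t + f s' \<le> f s + (2::nat))"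
  using assms(1)
proof (induction "f s" arbitrary: s rule: less_induct)
  case less
  show ?case
  proof (cases "fst s a < fst s b")
    case True
    then obtain t s' where 1: "big A B c s t s'" "I s'" "t + f s' + 2 \<le> f s"
      using assms(2)[OF less.prems] by (auto simp: wp_def)
    then obtain t' s'' where "big A B (WhileLess a b c) s' t' s''" "I s''"
      "\<not> fst s'' a < fst s'' b" "t' + f s'' \<le> f s' + 2"
      using less.hyps[of s'] by (auto simp: wp_def)
    then show ?thesis using big.WhileTrue[OF True 1(1)] 1(3)
      unfolding wp_def by (intro exI[of _ "t + t' + 2"] exI[of _ s'']) auto
  next
    case False
    then show ?thesis using less.prems big.WhileFalse[OF False] unfolding wp_def by fastforce
  qed
qed

section \<open>Linear growth of the register contents\<close>

text \<open>Only increments are allowed, so that the register contents grow by at most one per step.\<close>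
fun tame :: "nat \<Rightarrow> instr \<Rightarrow> bool" where
  "tame u (Const d v) = (if d = u then v = 1 else v \<le> 4)"
| "tame u (Add d a b) = (b = u \<and> d \<noteq> u)"
| "tame u (Sub d a b) = (d \<noteq> u)"
| "tame u (Div d a b) = (d \<noteq> u)"
| "tame u (Mod d a b) = (d \<noteq> u)"
| "tame u (LenA d) = (d \<noteq> u)"
| "tame u (QueryA d i) = (d \<noteq> u)"
| "tame u (ReadB d f) = (d \<noteq> u \<and> f \<noteq> u)"
| "tame u (Jlt a b l) = True"
| "tame u (Jmp l) = True"
| "tame u (Halt r) = True"
| "tame u (Mul d a b) = False"
| "tame u (Rand d r) = False"

lemma tame_not_rand: "tame u i \<Longrightarrow> \<not> is_rand i"
  by (cases i) auto

text \<open>The only tame write to \<open>u\<close> is the constant 1, so \<open>u\<close> never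
  exceeds 1 and every tame addition is at most an increment. All other tame instructions produce
  nothing above \<open>v\<close>.\<close>

lemma det_exec_bound:
  assumes "tame u i" "\<forall>r. regs s r \<le> v" "regs s u \<le> 1"
    and "4 \<le> v" "length A \<le> v" "\<forall>x \<in> set A \<union> set B. x \<le> v"
  shows "(\<forall>r. regs (det_exec i A B s) r \<le> Suc v) \<and> regs (det_exec i A B s) u \<le> 1"
proof (cases i)
  case (Add d a b)
  then have "regs s a + regs s u \<le> v + 1" using assms by (meson add_mono)
  with Add assms show ?thesis by (auto simp: le_Suc_eq)
next
  case (Sub d a b)
  have "regs s a - regs s b \<le> v" using assms by (meson diff_le_self le_trans)
  with Sub assms show ?thesis by (auto simp: le_SucI)
next
  case (Div d a b)
  have "regs s a div regs s b \<le> v" using assms by (meson div_le_dividend le_trans)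
  with Div assms show ?thesis by (auto simp: le_SucI)
next
  case (Mod d a b)
  have "regs s a mod regs s b \<le> v" using assms by (meson mod_less_eq_dividend le_trans)
  with Mod assms show ?thesis by (auto simp: le_SucI)
next
  case (ReadB d f)
  with assms show ?thesis by (auto simp: le_SucI)
qed (use assms in \<open>auto simp: le_SucI\<close>)

lemma run_bound:
  assumes "\<forall>i \<in> set P. tame u i"
    and "4 \<le> v" "length A \<le> v" "\<forall>x \<in> set A \<union> set B. x \<le> v"
  shows "(\<forall>r. regs ((dstep P A B ^^ k) init_cfg) r \<le> v + k) \<and> regs ((dstep P A B ^^ k) init_cfg) u \<le> 1"
proof (induction k)
  case 0
  then show ?case by (simp add: init_cfg_def)
next
  case (Suc k)
  define s where "s = (dstep P A B ^^ k) init_cfg"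
  have IH: "\<forall>r. regs s r \<le> v + k" "regs s u \<le> 1" using Suc by (simp_all add: s_def)
  have "(\<forall>r. regs (dstep P A B s) r \<le> v + Suc k) \<and> regs (dstep P A B s) u \<le> 1"
  proof (cases "result s \<noteq> None \<or> pc s \<ge> length P")
    case True
    then show ?thesis using IH by (auto simp: dstep_def le_SucI)
  next
    case False
    then have "tame u (P ! pc s)" using assms(1) by simp
    from det_exec_bound[OF this IH, of A B] False assms(2-) show ?thesis
      by (auto simp: dstep_def trans_le_add1)
  qed
  then show ?case by (simp add: s_def)
qed

section \<open>Periods and matches\<close>

text \<open>Pattern and text are total functions with explicit lengths \<open>lp\<close> and
  \<open>n\<close>, so that shifts and reversals need no list operations.\<close>

locale matching =
  fixes pat hay :: "nat \<Rightarrow> nat" and lp n :: nat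
begin

definition agrees :: "nat \<Rightarrow> nat \<Rightarrow> bool" where
  "agrees p q \<longleftrightarrow> p + q \<le> n \<and> q \<le> lp \<and> (\<forall>k<q. pat k = hay (p + k))"

text \<open>For \<open>p \<le> n\<close> the empty match agrees and \<open>lp\<close> bounds all
  matches, so the maximum exists. Beyond \<open>n\<close> nothing agrees and the value is
  arbitrary.\<close>

definition ext :: "nat \<Rightarrow> nat" where
  "ext p = (GREATEST q. agrees p q)"

lemma agrees_ext: "p \<le> n \<Longrightarrow> agrees p (ext p)"
  unfolding ext_def by (rule GreatestI_nat[of _ 0 lp]) (auto simp: agrees_def)

lemma ext_greatest: "agrees p q \<Longrightarrow> q \<le> ext p"
  unfolding ext_def by (rule Greatest_le_nat[of _ _ lp]) (auto simp: agrees_def)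

lemma ext_eqI:
  assumes "agrees p q" "q = lp \<or> p + q = n \<or> pat q \<noteq> hay (p + q)"
  shows "ext p = q"
proof (rule ccontr)
  assume "ext p \<noteq> q"
  then have "q < ext p" using ext_greatest[OF assms(1)] by simp
  moreover have "agrees p (ext p)" using assms(1) by (intro agrees_ext) (simp add: agrees_def)
  ultimately show False using assms(2) by (auto simp: agrees_def)
qed

lemma ext_mismatch: "p + ext p < n \<Longrightarrow> ext p < lp \<Longrightarrow> pat (ext p) \<noteq> hay (p + ext p)"
proof
  assume a: "p + ext p < n" "ext p < lp" "pat (ext p) = hay (p + ext p)"
  have "agrees p (ext p)" using a(1) by (intro agrees_ext) simp
  then have "agrees p (Suc (ext p))" using a by (auto simp: agrees_def less_Suc_eq)
  then show False using ext_greatest by fastforce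
qed

section \<open>Periods of the prefixes of the pattern\<close>

definition periodic :: "nat \<Rightarrow> nat \<Rightarrow> bool" where
  "periodic q t \<longleftrightarrow> 0 < t \<and> (\<forall>x. x + t < q \<longrightarrow> pat x = pat (x + t))"

definition minper :: "nat \<Rightarrow> nat \<Rightarrow> bool" where
  "minper q t \<longleftrightarrow> periodic q t \<and> (\<forall>u<t. \<not> periodic q u)"

lemma minper_exists: "periodic q t \<Longrightarrow> \<exists>u\<le>t. minper q u"
  unfolding minper_def by (metis exists_least_iff linorder_le_cases not_less_iff_gr_or_eq order.strict_iff_not)

lemma periodic_mod: "periodic q t \<Longrightarrow> x < q \<Longrightarrow> pat x = pat (x mod t)"
proof (induction x rule: less_induct)
  case (less x)
  show ?case
  proof (cases "x < t")
    case False
    have "0 < t" "x - t + t < q \<Longrightarrow> pat (x - t) = pat (x - t + t)"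
      using less.prems unfolding periodic_def by blast+
    with False less have "pat (x - t) = pat ((x - t) mod t)" "pat (x - t) = pat x"
      by simp_all
    then show ?thesis using False by (simp add: le_mod_geq)
  qed simp
qed

text \<open>The word of a shortest period is primitive: if rotating it by \<open>u\<close> fixes it
  and \<open>u mod t\<close> is positive, then \<open>u mod t\<close> is a shorter period.\<close>

lemma minper_dvd:
  assumes "minper q t" "t \<le> q" "\<And>k. k < t \<Longrightarrow> pat k = pat ((k + u) mod t)"
  shows "t dvd u"
proof (rule ccontr)
  assume "\<not> t dvd u"
  then have g: "0 < u mod t" by (simp add: mod_greater_zero_iff_not_dvd)
  have p: "periodic q t" "0 < t" using assms(1) by (auto simp: minper_def periodic_def)
  have "pat x = pat (x + u mod t)" if "x + u mod t < q" for x
  proof -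
    have "pat x = pat (x mod t)" using that by (intro periodic_mod[OF p(1)]) simp
    also have "\<dots> = pat ((x mod t + u) mod t)" using p by (intro assms(3)) simp
    also have "(x mod t + u) mod t = (x + u mod t) mod t" by (simp add: mod_simps)
    also have "pat \<dots> = pat (x + u mod t)" using that periodic_mod[OF p(1)] by simp
    finally show ?thesis .
  qed
  then have "periodic q (u mod t)" using g by (simp add: periodic_def)
  then show False using assms(1) p by (simp add: minper_def)
qed

text \<open>A weak form of the theorem of Fine and Wilf. As \<open>t + u \<le> q\<close>, shifting
  the whole first period by \<open>u\<close> stays inside the prefix, so the shift is a rotation
  that fixes it.\<close>

lemma minper_dvd_periodic:
  assumes "minper q t" "periodic q u" "t + u \<le> q"
  shows "t dvd u"
proof (rule minper_dvd[OF assms(1)])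
  fix k assume "k < t"
  then have "pat k = pat (k + u)" using assms by (auto simp: periodic_def)
  also have "\<dots> = pat ((k + u) mod t)"
    using assms \<open>k < t\<close> by (intro periodic_mod) (auto simp: minper_def)
  finally show "pat k = pat ((k + u) mod t)" .
qed (use assms in simp)

lemma skip_aperiodic:
  assumes "p < p'" "p' \<le> p + ext p div 4" "p' \<le> n"
    and "\<And>t. 4 * t \<le> ext p \<Longrightarrow> \<not> periodic (ext p) t"
  shows "ext p' \<le> ext p"
proof (rule ccontr)
  assume a: "\<not> ext p' \<le> ext p"
  have e: "agrees p (ext p)" "agrees p' (ext p')" using assms by (auto intro: agrees_ext)
  \<comment> \<open>A longer match at \<open>p'\<close> overlaps the match at \<open>p\<close>, and
    two overlapping copies of the same prefix make their distance a period of it.\<close>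
  have "pat x = pat (x + (p' - p))" if "x + (p' - p) < ext p" for x
  proof -
    have "pat x = hay (p' + x)" using e(2) a that by (simp add: agrees_def)
    also have "p' + x = p + (x + (p' - p))" using assms(1) by simp
    also have "hay \<dots> = pat (x + (p' - p))" using e(1) that by (simp add: agrees_def)
    finally show ?thesis .
  qed
  then have "periodic (ext p) (p' - p)" using assms(1) by (simp add: periodic_def)
  moreover have "4 * (p' - p) \<le> ext p" using assms(1,2) by linarith
  ultimately show False using assms(4) by blast
qed

definition reaches :: "nat \<Rightarrow> nat \<Rightarrow> nat \<Rightarrow> bool" where
  "reaches p t r \<longleftrightarrow> r \<le> n \<and> (\<forall>x\<ge>p. x + t < r \<longrightarrow> hay x = hay (x + t))"

lemma reaches_mod: "reaches p t r \<Longrightarrow> p + x < r \<Longrightarrow> hay (p + x) = hay (p + x mod t)"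
proof (induction x rule: less_induct)
  case (less x)
  show ?case
  proof (cases "x < t \<or> t = 0")
    case True
    then show ?thesis by auto
  next
    case False
    then have "hay (p + (x - t)) = hay (p + (x - t) mod t)"
      using less by (intro less.IH) auto
    moreover have "hay (p + (x - t)) = hay (p + (x - t) + t)" using less False
      unfolding reaches_def by (metis add.assoc le_add1 le_add_diff_inverse2 not_less)
    ultimately show ?thesis using False by (simp add: le_mod_geq)
  qed
qed

text \<open>The strict inequalities say that the match at \<open>p\<close> ends by a mismatch. The
  last conjunct makes \<open>r\<close> the maximal end of the run, which may lie well beyond the
  match.\<close>

definition long_run :: "nat \<Rightarrow> nat \<Rightarrow> nat \<Rightarrow> bool" where
  "long_run p t r \<longleftrightarrow> p + ext p < n \<and> ext p < lp \<and> minper (ext p) t \<and> 4 * t \<le> ext p \<and>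
     p + ext p \<le> r \<and> reaches p t r \<and> (r = n \<or> hay r \<noteq> hay (r - t))"

lemma run_hay:
  assumes "long_run p t r" "p + x < r"
  shows "hay (p + x) = pat (x mod t)"
proof -
  have "hay (p + x) = hay (p + x mod t)" using assms reaches_mod by (auto simp: long_run_def)
  moreover have "agrees p (ext p)" using assms by (intro agrees_ext) (simp add: long_run_def)
  moreover have "x mod t < ext p"
    using assms by (intro less_le_trans[OF mod_less_divisor]) (auto simp: long_run_def minper_def periodic_def)
  ultimately show ?thesis by (simp add: agrees_def)
qed

text \<open>A longer match at \<open>p'\<close> would contain the whole prefix of length
  \<open>ext p\<close>. The cases compare the end of this copy with the end \<open>r\<close> of the
  run.\<close>

lemma skip_run:
  assumes run: "long_run p t r" and "p < p'" "p' + ext p div 2 < r"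
    and ndvd: "p' + ext p = r \<Longrightarrow> \<not> t dvd p' - p"
  shows "ext p' \<le> ext p"
proof (rule ccontr)
  assume a: "\<not> ext p' \<le> ext p"
  define q where "q = ext p"
  have per: "periodic q t" "0 < t" "4 * t \<le> q" "minper q t"
    using run by (auto simp: long_run_def q_def minper_def periodic_def)
  have rn: "r \<le> n" "p + q \<le> r" "p + q < n" "q < lp"
    using run by (auto simp: long_run_def reaches_def q_def)
  have e: "agrees p q" "agrees p' (ext p')" using assms rn by (auto intro!: agrees_ext simp: q_def)
  have pe: "pat k = hay (p' + k)" if "k \<le> q" for k using e(2) a that by (simp add: agrees_def q_def)
  consider "p' + q < r" | "p' + q = r" | "r < p' + q" by linarith
  then show False
  proof cases
    \<comment> \<open>The run still covers position \<open>q\<close> of the longer match, so the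
      pattern continues with period \<open>t\<close> there. The text does the same at
      \<open>p + q\<close>, against the mismatch.\<close>
    case 1
    have T: "hay x = hay (x + t)" if "p \<le> x" "x + t < r" for x
      using that run by (auto simp: long_run_def reaches_def)
    have "pat q = hay (p' + q)" by (simp add: pe)
    also have "\<dots> = hay (p' + (q - t))" using T[of "p' + (q - t)"] 1 assms(2) per by simp
    also have "\<dots> = pat (q - t)" by (simp add: pe)
    also have "\<dots> = hay (p + (q - t))" using e(1) per by (simp add: agrees_def)
    also have "\<dots> = hay (p + q)" using T[of "p + (q - t)"] 1 assms(2) per by simp
    finally show False using ext_mismatch rn by (simp add: q_def)
  next
    \<comment> \<open>The first \<open>t\<close> pattern characters recur inside the run with phase
      \<open>p' - p\<close>, so this rotation fixes the period word.\<close>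
    case 2
    have "t dvd p' - p"
    proof (rule minper_dvd[OF per(4)])
      fix k assume k: "k < t"
      have "pat k = hay (p + (k + (p' - p)))" using pe[of k] k per assms(2) by (simp add: add.commute)
      also have "\<dots> = pat ((k + (p' - p)) mod t)" using 2 k per assms(2) by (intro run_hay[OF run]) simp
      finally show "pat k = pat ((k + (p' - p)) mod t)" .
    qed (use per in simp)
    then show False using ndvd 2 by (simp add: q_def)
  next
    \<comment> \<open>The break of the run at \<open>r\<close> would fall inside a copy of a
      \<open>t\<close>-periodic prefix. As \<open>r - p'\<close> exceeds \<open>q div 2\<close>, the
      position one period earlier is still inside this copy.\<close>
    case 3
    have h: "p' + q div 2 < r" using assms(3) by (simp add: q_def)
    have "r < n" using 3 e(2) a by (auto simp: agrees_def q_def)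
    then have "hay r \<noteq> hay (r - t)" using run by (auto simp: long_run_def)
    moreover have "hay r = pat (r - p')" using pe[of "r - p'"] 3 h by simp
    moreover have "hay (r - t) = pat (r - p' - t)"
      using pe[of "r - p' - t"] 3 h per by simp
    moreover have "pat (r - p' - t) = pat (r - p' - t + t)"
    proof -
      have "r - p' - t + t < q" using 3 h per by simp
      then show ?thesis using per(1) unfolding periodic_def by blast
    qed
    ultimately show False using h per by simp
  qed
qed

section \<open>Amortised cost of the jumps\<close>

definition short :: "nat \<Rightarrow> bool" where
  "short p \<longleftrightarrow> p + ext p < n \<and> ext p < lp \<and>
     (\<exists>t. minper (ext p) t \<and> 4 * t \<le> ext p \<and> hay (p + ext p) = hay (p + ext p - t))"

text \<open>The amortised cost: a jump that is short compared to \<^term>\<open>ext p\<close> is paid for by the growth of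
  the weight, all others by their length.\<close>
definition weight :: "nat \<Rightarrow> nat" where
  "weight p = (if n \<le> p then 0 else if short p then ext p else 2 * ext p)"

lemma ext_le: "p \<le> n \<Longrightarrow> p + ext p \<le> n"
  using agrees_ext by (simp add: agrees_def)

lemma weight_le: "weight p \<le> 2 * (n - p)"
  using ext_le[of p] by (cases "p \<le> n") (auto simp: weight_def)

text \<open>The weight at \<open>p\<close> is at most \<open>2 * ext p\<close>, so the left side is
  at most three times \<open>ext p\<close>; this gives the factor 12.\<close>

lemma weight_long: "p < p' \<Longrightarrow> ext p \<le> 4 * (p' - p) \<Longrightarrow> ext p + weight p \<le> 12 * (p' - p) + weight p'"
  by (simp add: weight_def)

lemma weight_short:
  assumes run: "long_run p t r" and "p + ext p < r" and dvd: "t dvd r - ext p - p"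
  shows "ext p + weight p \<le> weight (r - ext p)"
proof -
  define q where "q = ext p"
  define p' where "p' = r - q"
  have per: "periodic q t" "0 < t" "4 * t \<le> q" "minper q t"
    using run by (auto simp: long_run_def q_def minper_def periodic_def)
  have rn: "r \<le> n" "p + q < r" "p + q < n" "q < lp"
    using run assms(2) by (auto simp: long_run_def reaches_def q_def)
  have T: "hay x = hay (x + t)" if "p \<le> x" "x + t < r" for x
    using that run by (auto simp: long_run_def reaches_def)
  have e: "agrees p q" using rn by (auto intro!: agrees_ext simp: q_def)
  have mis: "pat q \<noteq> hay (p + q)" using rn ext_mismatch by (simp add: q_def)
  have p': "p < p'" "p' + q = r" "p' < n" using rn per by (auto simp: p'_def)
  have cont: "hay (p + q) = hay (p + q - t)" using T[of "p + q - t"] rn per by simp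
  \<comment> \<open>The text keeps the period at the mismatch, so it is the pattern that breaks
    it.\<close>
  have brk: "pat q \<noteq> pat (q - t)" using e cont mis per by (simp add: agrees_def)
  \<comment> \<open>Being short, \<open>p\<close> has weight only \<open>q\<close>. It remains to
    show that the weight at \<open>p'\<close> is at least \<open>2 * q\<close>.\<close>
  have "short p" unfolding short_def using rn per cont by (auto simp: q_def)
  then have wp: "weight p = q" using rn by (simp add: weight_def q_def)
  \<comment> \<open>Divisibility puts \<open>p'\<close> in phase with \<open>p\<close>, and the run
    reaches exactly to \<open>p' + q\<close>, so the whole prefix recurs at
    \<open>p'\<close>.\<close>
  have "agrees p' q" unfolding agrees_def
  proof (intro conjI allI impI)
    fix k assume k: "k < q"
    have "hay (p' + k) = hay (p + ((p' - p) + k))" using p' by simp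
    also have "\<dots> = pat (((p' - p) + k) mod t)" using p' k by (intro run_hay[OF run]) simp
    also have "((p' - p) + k) mod t = k mod t" using dvd by (auto simp: p'_def q_def elim!: dvdE)
    also have "pat \<dots> = pat k" using periodic_mod[OF per(1) k] by simp
    finally show "pat k = hay (p' + k)" by simp
  qed (use rn p' in simp_all)
  then have q': "q \<le> ext p'" by (rule ext_greatest)
  have "2 * q \<le> weight p'"
  proof (cases "short p'")
    case True
    define q' where "q' = ext p'"
    obtain t' where t': "minper q' t'" "4 * t' \<le> q'" "hay (p' + q') = hay (p' + q' - t')"
      using True unfolding short_def q'_def by blast
    have pp: "p' + q' < n" using True by (simp add: short_def q'_def)
    have per': "periodic q' t'" "0 < t'" using t' by (auto simp: minper_def periodic_def)
    \<comment> \<open>Equal lengths have equal shortest periods, but the text breaks period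
      \<open>t\<close> at \<open>r\<close>, which is \<open>p' + q\<close>, while a short
      \<open>p'\<close> needs it to continue there.\<close>
    have "q' \<noteq> q"
    proof
      assume "q' = q"
      then have "t' = t" using t'(1) per(4) unfolding minper_def by (meson linorder_neqE_nat)
      then show False using t'(3) pp p' run \<open>q' = q\<close> by (auto simp: long_run_def)
    qed
    then have less: "q < q'" using q' by (simp add: q'_def)
    \<comment> \<open>Otherwise \<open>t\<close> divides \<open>t'\<close> by Fine and Wilf. The
      longer prefix has period \<open>t'\<close>, so position \<open>q\<close> would repeat the
      \<open>t\<close>-periodic part, contrary to \<open>brk\<close>.\<close>
    have "q < t + t'"
    proof (rule ccontr)
      assume "\<not> q < t + t'"
      then have le: "t + t' \<le> q" by simp
      have "periodic q t'" using per' less by (auto simp: periodic_def)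
      then have d: "t dvd t'" using minper_dvd_periodic[OF per(4) _ le] by simp
      have "pat q = pat (q - t')" using per' less le unfolding periodic_def
        by (metis add.commute add_leD1 add_leD2 le_add_diff_inverse2)
      also have "\<dots> = pat ((q - t') mod t)" using le per' by (intro periodic_mod[OF per(1)]) simp
      also have "(q - t') mod t = (q - t) mod t"
      proof -
        obtain m where m: "t' = t * m" using d by blast
        then have "0 < m" using per' by simp
        have "(q - t) = (q - t') + t * (m - 1)" using m le \<open>0 < m\<close> by (cases m) simp_all
        then show ?thesis by simp
      qed
      also have "pat \<dots> = pat (q - t)" using per le by (intro periodic_mod[OF per(1), symmetric]) simp
      finally show False using brk by simp
    qed
    \<comment> \<open>With four periods in each prefix, \<open>4 * q < 4 * t + 4 * t'\<close>, and
      the right side is at most \<open>q + q'\<close>.\<close>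
    then have "2 * q \<le> q'" using per(3) t'(2) by linarith
    then show ?thesis using True p' by (simp add: weight_def q'_def)
  next
    case False
    then show ?thesis using p' q' by (simp add: weight_def)
  qed
  then show ?thesis by (simp add: wp flip: q_def p'_def)
qed

section \<open>Maximal rotations of the period word, found with two pointers\<close>

definition beats :: "nat \<Rightarrow> nat \<Rightarrow> nat \<Rightarrow> bool" where
  "beats t a b \<longleftrightarrow>
     (\<exists>k. pat ((b + k) mod t) < pat ((a + k) mod t) \<and> (\<forall>l<k. pat ((b + l) mod t) = pat ((a + l) mod t)))"

lemma beats_irrefl: "\<not> beats t a a"
  by (simp add: beats_def)

lemma beats_trans:
  assumes "beats t a b" "beats t b c"
  shows "beats t a c"
proof -
  obtain k where k: "pat ((b + k) mod t) < pat ((a + k) mod t)"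
    "\<And>l. l < k \<Longrightarrow> pat ((b + l) mod t) = pat ((a + l) mod t)"
    using assms(1) unfolding beats_def by blast
  obtain k' where k': "pat ((c + k') mod t) < pat ((b + k') mod t)"
    "\<And>l. l < k' \<Longrightarrow> pat ((c + l) mod t) = pat ((b + l) mod t)"
    using assms(2) unfolding beats_def by blast
  have "pat ((c + min k k') mod t) < pat ((a + min k k') mod t)"
    using k(1) k'(1) k(2)[of k'] k'(2)[of k] by (cases k k' rule: linorder_cases) (auto simp: min_def)
  then show ?thesis using k(2) k'(2) unfolding beats_def by (intro exI[of _ "min k k'"]) auto
qed

lemma beats_mod: "beats t a (b mod t) = beats t a b" "beats t (a mod t) b = beats t a b"
  by (simp_all add: beats_def mod_simps)

text \<open>For positive \<open>t\<close>, the rotation of the first \<open>t\<close> characters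
  starting at \<open>x\<close> is lexicographically maximal. Starts are not reduced modulo
  \<open>t\<close>, so each maximal rotation has infinitely many of them.\<close>

definition unbeaten :: "nat \<Rightarrow> nat \<Rightarrow> bool" where
  "unbeaten t x \<longleftrightarrow> (\<forall>y. \<not> beats t y x)"

lemma unbeaten_exists:
  assumes "0 < t"
  shows "\<exists>x<t. unbeaten t x"
proof -
  have "\<exists>x\<in>S. \<forall>y\<in>S. \<not> beats t y x" if "finite S" "S \<noteq> {}" for S
    using that
  proof (induction rule: finite_ne_induct)
    case (singleton x)
    then show ?case by (simp add: beats_irrefl)
  next
    case (insert x S)
    then obtain m where m: "m \<in> S" "\<forall>y\<in>S. \<not> beats t y m" by blast
    then show ?case
      using beats_irrefl beats_trans by (cases "beats t x m") (metis insert_iff)+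
  qed
  from this[of "{..<t}"] obtain x where x: "x < t" "\<And>y. y < t \<Longrightarrow> \<not> beats t y x"
    using assms by auto
  have "\<not> beats t y x" for y
    using x(2)[of "y mod t"] assms by (simp add: beats_mod)
  then show ?thesis using x(1) by (auto simp: unbeaten_def)
qed

text \<open>The state of a two-pointer search for a maximal rotation of the shortest period of
  \<^term>\<open>pat\<close> on \<^term>\<open>{..<q}\<close>: the rotations starting at \<^term>\<open>i\<close> and \<^term>\<open>j\<close> agree up to
  \<^term>\<open>ik\<close> and \<^term>\<open>jk\<close>, and every discarded start is beaten.\<close>
definition duel :: "nat \<Rightarrow> nat \<Rightarrow> nat \<Rightarrow> nat \<Rightarrow> nat \<Rightarrow> bool" where
  "duel q i j ik jk \<longleftrightarrow> i \<noteq> j \<and> i \<le> ik \<and> j \<le> jk \<and> ik - i = jk - j \<and> ik \<le> q \<and> jk \<le> q \<and>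
     (\<forall>k < ik - i. pat (i + k) = pat (j + k)) \<and>
     (\<forall>t x. minper q t \<and> unbeaten t x \<longrightarrow> x = i \<or> x = j \<or> i < x \<and> j < x)"

lemma duel_sym: "duel q i j ik jk \<Longrightarrow> duel q j i jk ik"
  by (auto simp: duel_def)

lemma duel_init: "1 \<le> q \<Longrightarrow> duel q 0 1 0 1"
  by (auto simp: duel_def)

lemma duel_equal:
  assumes "duel q i j ik jk" "ik < q" "jk < q" "pat ik = pat jk"
  shows "duel q i j (ik + 1) (jk + 1)"
proof -
  have e: "ik = i + (ik - i)" "jk = j + (ik - i)" using assms(1) by (auto simp: duel_def)
  have "pat (i + k) = pat (j + k)" if "k < ik + 1 - i" for k
  proof (cases "k < ik - i")
    case True
    then show ?thesis using assms(1) by (simp add: duel_def)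
  next
    case False
    then have "k = ik - i" using that by simp
    then show ?thesis using assms(4) e by simp
  qed
  then show ?thesis using assms by (auto simp: duel_def)
qed

text \<open>The start \<open>i + x\<close> loses to \<open>j + x\<close> for every \<open>x\<close>
  up to the matched length, because both run into the same mismatch. Thus all starts from
  \<open>i\<close> to \<open>ik\<close> are discarded at once. One extra step keeps the candidates
  distinct.\<close>

lemma duel_less:
  assumes "duel q i j ik jk" "ik < q" "jk < q" "pat ik < pat jk"
    and "i' = (if ik + 1 = j then ik + 2 else ik + 1)"
  shows "duel q i' j i' j"
proof -
  define m where "m = ik - i"
  have d: "i \<noteq> j" "ik = i + m" "jk = j + m" "\<And>k. k < m \<Longrightarrow> pat (i + k) = pat (j + k)"
    "\<And>t x. minper q t \<Longrightarrow> unbeaten t x \<Longrightarrow> x = i \<or> x = j \<or> i < x \<and> j < x"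
    using assms(1) by (auto simp: duel_def m_def)
  have beaten: "\<not> unbeaten t (i + x)" if t: "minper q t" and x: "x \<le> m" for t x
  proof -
    have per: "periodic q t" using t by (simp add: minper_def)
    have "beats t (j + x) (i + x)" unfolding beats_def
    proof (intro exI[of _ "m - x"] conjI allI impI)
      show "pat ((i + x + (m - x)) mod t) < pat ((j + x + (m - x)) mod t)"
        using x assms(2-4) d(2,3) periodic_mod[OF per] by simp
      fix l assume "l < m - x"
      then show "pat ((i + x + l) mod t) = pat ((j + x + l) mod t)"
        using d(4)[of "x + l"] assms(2,3) d(2,3) periodic_mod[OF per, of "i + (x + l)"]
          periodic_mod[OF per, of "j + (x + l)"] by (simp add: add.assoc)
    qed
    then show ?thesis by (auto simp: unbeaten_def)
  qed
  have "x = i' \<or> x = j \<or> i' < x \<and> j < x" if t: "minper q t" "unbeaten t x" for t x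
  proof -
    have "\<not> (i \<le> x \<and> x \<le> ik)"
    proof
      assume "i \<le> x \<and> x \<le> ik"
      then have "x = i + (x - i)" "x - i \<le> m" using d(2) by auto
      then show False using beaten[OF t(1)] t(2) by metis
    qed
    then show ?thesis using d(2) d(5)[OF t] assms(5) by auto
  qed
  then have "\<forall>t x. minper q t \<and> unbeaten t x \<longrightarrow> x = i' \<or> x = j \<or> i' < x \<and> j < x" by blast
  moreover have "i' \<noteq> j" "i' \<le> q" "j \<le> q" using assms(2,3,5) d(1,3) by auto
  ultimately show ?thesis by (simp add: duel_def)
qed

text \<open>Maximal starts recur at distance \<open>t\<close> and are never discarded, which keeps
  \<open>j\<close> below \<open>2 * t\<close>. The candidates then agree over a full period, so
  \<open>j - i\<close> is a positive multiple of \<open>t\<close> below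
  \<open>2 * t\<close>.\<close>

lemma duel_end_aux:
  assumes D: "duel q i j ik jk" and "ik = q \<or> jk = q" and t: "minper q t" "4 * t \<le> q" and "i < j"
  shows "j - i = t"
proof -
  have per: "periodic q t" "0 < t" using t(1) by (auto simp: minper_def periodic_def)
  obtain b where b: "b < t" "unbeaten t b" using unbeaten_exists per(2) by blast
  have "beats t y (b + t) = beats t y b" for y
    using beats_mod(1)[of t y "b + t"] beats_mod(1)[of t y b] by simp
  then have b': "unbeaten t (b + t)" using b(2) by (simp add: unbeaten_def)
  have "x = i \<or> x = j \<or> i < x \<and> j < x" if "unbeaten t x" for x
    using that D t(1) unfolding duel_def by blast
  \<comment> \<open>If \<open>b + t\<close> were \<open>i\<close>, the unbeaten \<open>b\<close>
    would lie below both candidates. Hence \<open>j\<close> is at most \<open>b + t\<close>.\<close>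
  from this[OF b(2)] this[OF b'] have j: "j < 2 * t" using b(1) \<open>i < j\<close> by auto
  have m: "jk = q" using assms(2) D \<open>i < j\<close> by (auto simp: duel_def)
  have eq: "pat (i + k) = pat (j + k)" if "k < t" for k
    using D m that j t(2) \<open>i < j\<close> unfolding duel_def by auto
  have "t dvd j - i"
  proof (rule minper_dvd[OF t(1)])
    fix k assume "k < t"
    \<comment> \<open>The offset at which the rotation starting at \<open>i\<close> reads pattern
      position \<open>k\<close>. Adding \<open>t * i\<close> avoids truncation in the
      subtraction.\<close>
    define l where "l = (k + t * i - i) mod t"
    have l: "l < t" using per(2) by (simp add: l_def)
    have ti: "i \<le> t * i" using per(2) by simp
    have "(i + l) mod t = (i + (k + t * i - i)) mod t" by (simp add: l_def mod_simps)
    also have "i + (k + t * i - i) = k + t * i" using ti by linarith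
    also have "\<dots> mod t = k" using \<open>k < t\<close> by simp
    finally have il: "(i + l) mod t = k" .
    have "pat k = pat (i + l)"
      using periodic_mod[OF per(1), of "i + l"] il l j t(2) \<open>i < j\<close> by simp
    also have "\<dots> = pat (j + l)" using eq l by simp
    also have "\<dots> = pat ((j + l) mod t)" using l j t(2) by (intro periodic_mod[OF per(1)]) simp
    also have "j + l = (i + l) + (j - i)" using \<open>i < j\<close> by simp
    also have "\<dots> mod t = ((i + l) mod t + (j - i)) mod t" by (simp only: mod_add_left_eq)
    finally show "pat k = pat ((k + (j - i)) mod t)" by (simp add: il)
  qed (use t(2) in simp)
  then obtain c where c: "j - i = t * c" by blast
  then have "t * c < t * 2" "0 < t * c" using j \<open>i < j\<close> by linarith+
  then have "c = 1" by simp
  then show ?thesis using c by simp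
qed

lemma duel_end:
  assumes "duel q i j ik jk" and "ik = q \<or> jk = q" and "minper q t" "4 * t \<le> q"
  shows "(if i < j then j - i else i - j) = t"
proof (cases "i < j")
  case True
  then show ?thesis using duel_end_aux[OF assms] by simp
next
  case False
  then have "j < i" using assms(1) by (auto simp: duel_def)
  then show ?thesis using duel_end_aux[OF duel_sym[OF assms(1)]] assms(2-) by auto
qed

end

section \<open>The program\<close>

text \<open>Registers are numbered by nesting depth of the loops, so that an inner loop preserves all
  registers below its own range.\<close>
abbreviation (input) "rZ \<equiv> 2 :: nat"
abbreviation (input) "rU \<equiv> 3 :: nat"
abbreviation (input) "rTwo \<equiv> 4 :: nat"
abbreviation (input) "rFour \<equiv> 5 :: nat"
abbreviation (input) "rN \<equiv> 6 :: nat"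
abbreviation (input) "rN1 \<equiv> 7 :: nat"
abbreviation (input) "rG \<equiv> 8 :: nat"
abbreviation (input) "rS \<equiv> 9 :: nat"
abbreviation (input) "rL \<equiv> 10 :: nat"
abbreviation (input) "rC \<equiv> 11 :: nat"
abbreviation (input) "rF \<equiv> 12 :: nat"
abbreviation (input) "rLP \<equiv> 13 :: nat"
abbreviation (input) "rP \<equiv> 20 :: nat"
abbreviation (input) "rBP \<equiv> 21 :: nat"
abbreviation (input) "rBQ \<equiv> 22 :: nat"
abbreviation (input) "rQ \<equiv> 30 :: nat"
abbreviation (input) "rE \<equiv> 31 :: nat"
abbreviation (input) "rD \<equiv> 32 :: nat"
abbreviation (input) "rV \<equiv> 33 :: nat"
abbreviation (input) "rI \<equiv> 40 :: nat"
abbreviation (input) "rJ \<equiv> 41 :: nat"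
abbreviation (input) "rIK \<equiv> 42 :: nat"
abbreviation (input) "rJK \<equiv> 43 :: nat"
abbreviation (input) "rLim \<equiv> 44 :: nat"
abbreviation (input) "rT \<equiv> 34 :: nat"
abbreviation (input) "rR \<equiv> 46 :: nat"
abbreviation (input) "rW \<equiv> 47 :: nat"
abbreviation (input) "rX \<equiv> 50 :: nat"
abbreviation (input) "rY \<equiv> 51 :: nat"
abbreviation (input) "rA \<equiv> 52 :: nat"

definition mov :: "nat \<Rightarrow> nat \<Rightarrow> com" where "mov d a = Bas (Sub d a rZ)"
definition inc :: "nat \<Rightarrow> com" where "inc d = Bas (Add d d rU)"
text \<open>Leaves the enclosing loop by setting its bound to zero.\<close>

definition stop :: com where "stop = Bas (Const rLim 0)"

text \<open>The pattern is never stored: it is read from \<open>A\<close> at the remembered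
  occurrence, and at position 0 the queried value is replaced by the new stream character.\<close>

definition getP :: "nat \<Rightarrow> nat \<Rightarrow> com" where
  "getP x d = Bas (Sub rA rN rS) ;; Bas (Sub rA rA x) ;; Bas (QueryA d rA) ;; IfLess rZ x SKIP (mov d rC)"

definition getT :: "nat \<Rightarrow> nat \<Rightarrow> com" where
  "getT x d = Bas (Sub rA rN1 x) ;; Bas (QueryA d rA)"

definition lcp_prog :: com where
  "lcp_prog = mov rE rP ;; Bas (Const rQ 0) ;; mov rLim rN ;;
     WhileLess rE rLim
       (IfLess rQ rLP
         (getP rQ rX ;; getT rE rY ;; IfLess rX rY stop (IfLess rY rX stop (inc rQ ;; inc rE)))
         stop)"

definition bump :: "nat \<Rightarrow> nat \<Rightarrow> com" where
  "bump a b = IfLess a b SKIP (IfLess b a SKIP (inc a)) ;; mov rIK rI ;; mov rJK rJ"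

definition duel_prog :: com where
  "duel_prog = Bas (Const rI 0) ;; Bas (Const rJ 1) ;; Bas (Const rIK 0) ;; Bas (Const rJK 1) ;;
     mov rLim rQ ;;
     WhileLess rIK rLim
       (IfLess rJK rQ
         (getP rIK rX ;; getP rJK rY ;;
          IfLess rX rY (Bas (Add rI rIK rU) ;; bump rI rJ)
            (IfLess rY rX (Bas (Add rJ rJK rU) ;; bump rJ rI) (inc rIK ;; inc rJK)))
         stop)"

definition verify_prog :: com where
  "verify_prog = Bas (Const rV 1) ;; Bas (Const rR 0) ;; mov rW rD ;;
     WhileLess rW rQ
       (getP rR rX ;; getP rW rY ;;
        IfLess rX rY (Bas (Const rV 0) ;; mov rW rQ)
          (IfLess rY rX (Bas (Const rV 0) ;; mov rW rQ) (inc rR ;; inc rW)))"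

definition dist_prog :: com where
  "dist_prog = IfLess rI rJ (Bas (Sub rD rJ rI)) (Bas (Sub rD rI rJ))"

text \<open>The distance found by the duel is meaningful only if a period of length at most
  \<open>q div 4\<close> exists, so it is first compared with this bound and then verified.\<close>

definition period_prog :: com where
  "period_prog = Bas (Const rV 0) ;; Bas (Div rT rQ rFour) ;;
     IfLess rZ rT
       (duel_prog ;; dist_prog ;; IfLess rT rD SKIP verify_prog)
       SKIP"

definition reach_prog :: com where
  "reach_prog = mov rR rE ;; Bas (Sub rW rE rD) ;; mov rLim rN ;;
     WhileLess rR rLim
       (getT rR rX ;; getT rW rY ;; IfLess rX rY stop (IfLess rY rX stop (inc rR ;; inc rW)))"

text \<open>As \<open>rE\<close> holds \<open>p + q\<close>, the difference \<open>rR - rE\<close>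
  is the length of the jump from \<open>p\<close> to \<open>r - q\<close>.\<close>

definition jump_prog :: com where
  "jump_prog = Bas (Div rT rQ rTwo) ;; Bas (Sub rP rR rT) ;;
     IfLess rE rR
       (Bas (Sub rT rR rE) ;; Bas (Mod rT rT rD) ;; IfLess rZ rT SKIP (Bas (Sub rP rR rQ)))
       SKIP"

definition update_prog :: com where
  "update_prog = IfLess rBQ rQ (mov rBQ rQ ;; mov rBP rP) SKIP"

text \<open>Tame programs add only increments, so \<open>p + q div 4 + 1\<close> is computed from
  the end of the match by subtraction.\<close>

definition advance_prog :: com where
  "advance_prog = IfLess rQ rLP
     (IfLess rE rN
       (period_prog ;;
        IfLess rZ rV (reach_prog ;; jump_prog)
          (Bas (Div rT rQ rFour) ;; Bas (Sub rT rQ rT) ;; inc rE ;; Bas (Sub rP rE rT)))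
       (mov rP rN))
     (mov rP rN)"

definition iter_prog :: com where
  "iter_prog = lcp_prog ;; update_prog ;; advance_prog"

definition search_prog :: com where
  "search_prog = Bas (Const rP 0) ;; Bas (Const rBQ 0) ;; Bas (Const rBP 0) ;; WhileLess rP rN iter_prog"

definition record_prog :: com where
  "record_prog = IfLess rG rL (mov rG rL) SKIP"

definition main_prog :: com where
  "main_prog = Bas (Const rU 1) ;; Bas (Const rTwo 2) ;; Bas (Const rFour 4) ;;
     Bas (LenA rN) ;; Bas (Sub rN1 rN rU) ;; Bas (ReadB rC rF) ;;
     WhileLess rZ rF
       (Bas (Add rLP rL rU) ;; search_prog ;; mov rS rBP ;; mov rL rBQ ;;
        record_prog ;; Bas (ReadB rC rF))"

definition agree :: "nat \<Rightarrow> (nat \<Rightarrow> nat) \<Rightarrow> (nat \<Rightarrow> nat) \<Rightarrow> bool" where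
  "agree k R R0 \<longleftrightarrow> (\<forall>r<k. R r = R0 r)"

lemma agree_upd [simp]: "k \<le> d \<Longrightarrow> agree k (R(d := v)) R0 = agree k R R0"
  by (auto simp: agree_def)

lemma agree_refl [simp]: "agree k R R"
  by (simp add: agree_def)

lemma agreeD: "agree k R R0 \<Longrightarrow> r < k \<Longrightarrow> R r = R0 r"
  by (simp add: agree_def)

lemma agree_trans: "agree k R1 R2 \<Longrightarrow> agree l R2 R3 \<Longrightarrow> m \<le> k \<Longrightarrow> m \<le> l \<Longrightarrow> agree m R1 R3"
  by (simp add: agree_def)

section \<open>One round: correctness and cost of processing a stream character\<close>

text \<open>The text \<open>hay\<close> is \<^term>\<open>A\<close> reversed. The pattern \<open>pat\<close> is the new character \<^term>\<open>c\<close> followed by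
  the current match read backwards, which is stored as the \<^term>\<open>l\<close> characters of \<open>hay\<close> from
  position \<^term>\<open>s\<close> on.\<close>
locale round =
  fixes A B :: "nat list" and s l c :: nat
  assumes sl: "s + l \<le> length A"
begin

abbreviation "n \<equiv> length A"

definition pat :: "nat \<Rightarrow> nat" where
  "pat k = (if k = 0 then c else A ! (n - s - k))"

definition hay :: "nat \<Rightarrow> nat" where
  "hay k = A ! (n - 1 - k)"

sublocale matching pat hay "Suc l" n .

definition good :: "(nat \<Rightarrow> nat) \<Rightarrow> bool" where
  "good R \<longleftrightarrow> R rZ = 0 \<and> R rU = 1 \<and> R rTwo = 2 \<and> R rFour = 4 \<and> R rN = n \<and> R rN1 = n - 1 \<and>
     R rS = s \<and> R rC = c \<and> R rLP = Suc l"

lemma good_upd [simp]: "20 \<le> d \<Longrightarrow> good (R(d := v)) = good R"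
  by (simp add: good_def)

lemma good_agree: "agree k R R0 \<Longrightarrow> 20 \<le> k \<Longrightarrow> good R0 \<Longrightarrow> good R"
  by (simp add: good_def agree_def)

lemma goodD:
  "good R \<Longrightarrow> R 2 = 0" "good R \<Longrightarrow> R 3 = 1" "good R \<Longrightarrow> R 4 = 2" "good R \<Longrightarrow> R 5 = 4"
  "good R \<Longrightarrow> R 6 = n" "good R \<Longrightarrow> R 7 = n - 1" "good R \<Longrightarrow> R 13 = Suc l"
  by (simp_all add: good_def)

lemma wp_mov: "good R \<Longrightarrow> wp A B (mov d a) (R, p) Q = Q 1 (R(d := R a), p)"
  by (simp add: mov_def good_def)

lemma wp_inc: "good R \<Longrightarrow> wp A B (inc d) (R, p) Q = Q 1 (R(d := Suc (R d)), p)"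
  by (simp add: inc_def good_def)

lemma wp_stop: "wp A B stop (R, p) Q = Q 1 (R(rLim := 0), p)"
  by (simp add: stop_def)

lemma wp_getP:
  assumes "good R" "R x \<le> l" "20 \<le> d" "d \<noteq> rA" "x \<noteq> rA" "x \<noteq> d"
  shows "wp A B (getP x d) (R, p) Q =
    Q (if R x = 0 then 6 else 4) (R(rA := n - s - R x, d := pat (R x)), p)"
proof (cases "R x = 0")
  case True
  then show ?thesis using assms by (simp add: getP_def mov_def good_def pat_def flip: numeral_2_eq_2)
next
  case False
  then have "n - s - R x < n" using assms(2) sl by simp
  with False show ?thesis using assms by (simp add: getP_def good_def pat_def flip: numeral_2_eq_2)
qed

lemma wp_getT:
  assumes "good R" "R x < n"
  shows "wp A B (getT x d) (R, p) Q = Q 2 (R(rA := n - 1 - R x, d := hay (R x)), p)"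
proof -
  have "n - Suc (R x) < n" using assms(2) by simp
  then show ?thesis using assms by (simp add: getT_def good_def hay_def flip: numeral_2_eq_2)
qed

lemmas wp_prims = wp_mov wp_inc wp_stop wp_getP wp_getT goodD

lemma wp_lcp:
  assumes g: "good R0" and p: "R0 rP = p" "p < n"
  shows "wp A B lcp_prog (R0, sp) (\<lambda>t s'. \<exists>R. s' = (R, sp) \<and> agree 30 R R0 \<and>
    R rQ = ext p \<and> R rE = p + ext p \<and> t \<le> 30 * ext p + 40)"
proof -
  define I where "I = (\<lambda>(R, sp'). sp' = sp \<and> agree 30 R R0 \<and> R rE = p + R rQ \<and> agrees p (R rQ) \<and>
     (R rLim = n \<or> R rLim = 0 \<and> R rQ = ext p))"
  \<comment> \<open>The extra 30 pays for the final round, which sets the bound to zero without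
    lengthening the match.\<close>
  define f where "f = (\<lambda>(R :: nat \<Rightarrow> nat, sp' :: nat). 30 * (ext p - R rQ) + (if R rLim = 0 then 0 else 30))"
  define body where "body = IfLess rQ rLP
         (getP rQ rX ;; getT rE rY ;; IfLess rX rY stop (IfLess rY rX stop (inc rQ ;; inc rE))) stop"
  define R1 where "R1 = R0(rE := p, rQ := 0, rLim := n)"
  have loop: "wp A B (WhileLess rE rLim body) (R1, sp)
     (\<lambda>t s'. I s' \<and> \<not> fst s' rE < fst s' rLim \<and> t + f s' \<le> f (R1, sp) + 2)"
  proof (rule wp_While)
    show "I (R1, sp)" using p by (auto simp: I_def R1_def agrees_def)
    fix st assume I: "I st" and lt: "fst st rE < fst st rLim"
    obtain R where st: "st = (R, sp)" using I by (auto simp: I_def)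
    have R: "agree 30 R R0" "R rE = p + R rQ" "agrees p (R rQ)" "R rLim = n" "p + R rQ < n"
      using I lt by (auto simp: I_def st)
    have gR: "good R" using good_agree[OF R(1) _ g] by simp
    have le: "R rQ \<le> ext p" using ext_greatest R(3) by simp
    have nx: "agrees p (Suc (R rQ))" if "R rQ < Suc l" "pat (R rQ) = hay (p + R rQ)"
      using R that by (auto simp: agrees_def less_Suc_eq)
    have eq: "ext p = R rQ" if "R rQ < Suc l \<Longrightarrow> pat (R rQ) \<noteq> hay (p + R rQ)"
      using R that by (intro ext_eqI) (auto simp: agrees_def)
    show "wp A B body st (\<lambda>t s'. I s' \<and> t + f s' + 2 \<le> f st)"
    proof (cases "R rQ < Suc l")
      case True
      show ?thesis
        using True gR R eq nx ext_greatest[OF nx] lt le unfolding body_def st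
        by (auto simp: wp_prims I_def f_def)
    next
      case False
      then show ?thesis
        using gR R eq lt unfolding body_def st by (auto simp: wp_prims I_def f_def)
    qed
  qed
  show ?thesis unfolding lcp_prog_def body_def[symmetric]
  proof (simp add: wp_prims g p R1_def[symmetric], rule wp_mono[OF loop], goal_cases)
    case (1 t s')
    then obtain R where s': "s' = (R, sp)" by (auto simp: I_def)
    have "R rQ = ext p" 
    proof (cases "R rLim = 0")
      case False
      then have "R rLim = n" "p + R rQ = n" "agrees p (R rQ)" using 1 by (auto simp: I_def s' agrees_def)
      then show ?thesis by (intro ext_eqI[symmetric]) auto
    qed (use 1 p in \<open>auto simp: I_def s'\<close>)
    then show ?case using 1 by (auto simp: I_def f_def s' R1_def split: if_splits)
  qed
qed

lemma wp_bump:
  assumes "good R" "a = rI \<and> b = rJ \<or> a = rJ \<and> b = rI"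
    and "R' = R(a := if R a = R b then Suc (R a) else R a)"
    and "\<And>t. t \<le> 7 \<Longrightarrow> Q t (R'(rIK := R' rI, rJK := R' rJ), p)"
  shows "wp A B (bump a b) (R, p) Q"
proof (cases "R a" "R b" rule: linorder_cases)
  case less
  then have "R' = R" using assms(3) by simp
  then show ?thesis using less assms(1,2) assms(4)[of 3] by (auto simp: bump_def wp_prims simp flip: numeral_2_eq_2)
next
  case equal
  then show ?thesis using assms(1,2) assms(4)[of 7]
    by (auto simp: assms(3) bump_def wp_prims simp flip: numeral_2_eq_2)
next
  case greater
  then have "R' = R" using assms(3) by simp
  then show ?thesis using greater assms(1,2) assms(4)[of 5]
    by (auto simp: bump_def wp_prims simp flip: numeral_2_eq_2)
qed

lemma wp_duel:
  assumes g: "good R0" and q: "R0 rQ = q" "1 \<le> q" "q \<le> Suc l"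
  shows "wp A B duel_prog (R0, sp) (\<lambda>t s'. \<exists>R i j ik jk. s' = (R, sp) \<and> agree 40 R R0 \<and>
    R rI = i \<and> R rJ = j \<and> duel q i j ik jk \<and> (ik = q \<or> jk = q) \<and> t \<le> 80 * q + 50)"
proof -
  define I where "I = (\<lambda>(R, sp'). sp' = sp \<and> agree 40 R R0 \<and>
     duel q (R rI) (R rJ) (R rIK) (R rJK) \<and> (R rLim = q \<or> R rLim = 0 \<and> R rJK = q))"
  \<comment> \<open>The invariant gives \<open>ik + j = i + jk\<close>, the sum of both starts and
    the matched length. A mismatch moves one start by more than the matched length, so this sum
    grows with every comparison although one pointer is reset.\<close>
  define f where "f = (\<lambda>(R :: nat \<Rightarrow> nat, sp' :: nat).
     40 * (2 * q - (R rIK + R rJ)) + (if R rLim = 0 then 0 else 30))"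
  define body where "body = IfLess rJK rQ
       (getP rIK rX ;; getP rJK rY ;;
          IfLess rX rY (Bas (Add rI rIK rU) ;; bump rI rJ)
            (IfLess rY rX (Bas (Add rJ rJK rU) ;; bump rJ rI) (inc rIK ;; inc rJK)))
         stop"
  define R1 where "R1 = R0(rI := 0, rJ := 1, rIK := 0, rJK := 1, rLim := q)"
  have loop: "wp A B (WhileLess rIK rLim body) (R1, sp)
     (\<lambda>t s'. I s' \<and> \<not> fst s' rIK < fst s' rLim \<and> t + f s' \<le> f (R1, sp) + 2)"
  proof (rule wp_While)
    show "I (R1, sp)" using q duel_init by (auto simp: I_def R1_def)
    fix st assume I: "I st" and lt: "fst st rIK < fst st rLim"
    obtain R where st: "st = (R, sp)" using I by (auto simp: I_def)
    define i j ik jk where v: "i = R rI" "j = R rJ" "ik = R rIK" "jk = R rJK"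
    have R: "agree 40 R R0" "duel q i j ik jk" "R rLim = q" "ik < q"
      using I lt by (auto simp: I_def st v)
    have gR: "good R" using good_agree[OF R(1) _ g] by simp
    have Q: "R rQ = q" using agreeD[OF R(1), of rQ] q by simp
    have b: "i \<le> ik" "j \<le> jk" "jk \<le> q" "ik - i = jk - j" "i \<noteq> j" using R(2) by (auto simp: duel_def)
    show "wp A B body st (\<lambda>t s'. I s' \<and> t + f s' + 2 \<le> f st)"
    proof (cases "jk < q")
      case True
      have le: "ik \<le> l" "jk \<le> l" using R True q by auto
      consider "pat ik < pat jk" | "pat jk < pat ik" | "pat ik = pat jk" by linarith
      then show ?thesis
      proof cases
        case 1
        define i' where "i' = (if ik + 1 = j then ik + 2 else ik + 1)"
        have D: "duel q i' j i' j" using duel_less[OF R(2) R(4) True 1 i'_def] .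
        then have le': "i' + j \<le> 2 * q" "ik + 1 \<le> i'" by (auto simp: duel_def i'_def)
        show ?thesis unfolding body_def st
          by (simp add: wp_prims gR Q True 1 le flip: v split del: if_split, rule wp_bump[OF _ _ refl])
            (use gR R(1,3) Q b v D le' in \<open>auto simp: I_def f_def i'_def split: if_splits\<close>)
      next
        case 2
        define j' where "j' = (if jk + 1 = i then jk + 2 else jk + 1)"
        have D: "duel q i j' i j'" using duel_less[OF duel_sym[OF R(2)] True R(4) 2 j'_def] by (rule duel_sym)
        then have le': "i + j' \<le> 2 * q" "jk + 1 \<le> j'" by (auto simp: duel_def j'_def)
        show ?thesis unfolding body_def st
          by (simp add: wp_prims gR Q True 2 order_less_not_sym[OF 2] le flip: v split del: if_split, rule wp_bump[OF _ _ refl])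
            (use gR R(1,3) Q b v D le' in \<open>auto simp: I_def f_def j'_def split: if_splits\<close>)
      next
        case 3
        then show ?thesis using True gR R(1,3,4) b Q le q duel_equal[OF R(2) R(4) True 3]
          unfolding body_def st by (auto simp: wp_prims I_def f_def simp flip: v)
      qed
    next
      case False
      then show ?thesis
        using gR R b Q q unfolding body_def st by (auto simp: wp_prims I_def f_def simp flip: v)
    qed
  qed
  show ?thesis unfolding duel_prog_def body_def[symmetric]
  proof (simp add: wp_prims g q R1_def[symmetric, simplified], rule wp_mono[OF loop], goal_cases)
    case (1 t s')
    then obtain R where s': "s' = (R, sp)" by (auto simp: I_def)
    have "R rIK = q \<or> R rJK = q" "duel q (R rI) (R rJ) (R rIK) (R rJK)"
      using 1 by (auto simp: I_def s' duel_def)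
    moreover have "t \<le> 80 * q + 44" using 1 q by (auto simp: I_def f_def s' R1_def split: if_splits)
    ultimately show ?case using 1 by (auto simp: I_def s')
  qed
qed

lemma wp_verify:
  assumes g: "good R0" and q: "R0 rQ = q" "q \<le> Suc l" and d: "R0 rD = d" "0 < d" "d \<le> q"
  shows "wp A B verify_prog (R0, sp) (\<lambda>t s'. \<exists>R. s' = (R, sp) \<and> agree 33 R R0 \<and>
    R rV = (if periodic q d then 1 else 0) \<and> t \<le> 30 * q + 50)"
proof -
  define ok where "ok w \<longleftrightarrow> (\<forall>x. x + d < w \<longrightarrow> pat x = pat (x + d))" for w
  have ok_Suc: "ok (Suc (r + d))" if "ok (r + d)" "pat r = pat (r + d)" for r
    unfolding ok_def
  proof (intro allI impI)
    fix x assume "x + d < Suc (r + d)"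
    then consider "x + d < r + d" | "x = r" by linarith
    then show "pat x = pat (x + d)"
    proof cases
      case 1
      then show ?thesis using that(1) unfolding ok_def by blast
    next
      case 2
      then show ?thesis using that(2) by simp
    qed
  qed
  define I where "I = (\<lambda>(R, sp'). sp' = sp \<and> agree 33 R R0 \<and> R rW \<le> q \<and>
     (R rV = 1 \<and> R rW = R rR + d \<and> ok (R rW) \<or>
      R rV = 0 \<and> R rW = q \<and> \<not> periodic q d))"
  define f where "f = (\<lambda>(R :: nat \<Rightarrow> nat, sp' :: nat). 30 * (q - R rW))"
  define body where "body = getP rR rX ;; getP rW rY ;;
        IfLess rX rY (Bas (Const rV 0) ;; mov rW rQ)
          (IfLess rY rX (Bas (Const rV 0) ;; mov rW rQ) (inc rR ;; inc rW))"
  define R1 where "R1 = R0(rV := 1, rR := 0, rW := d)"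
  have loop: "wp A B (WhileLess rW rQ body) (R1, sp)
     (\<lambda>t s'. I s' \<and> \<not> fst s' rW < fst s' rQ \<and> t + f s' \<le> f (R1, sp) + 2)"
  proof (rule wp_While)
    show "I (R1, sp)" using d by (auto simp: I_def R1_def ok_def)
    fix st assume I: "I st" and lt: "fst st rW < fst st rQ"
    obtain R where st: "st = (R, sp)" using I by (auto simp: I_def)
    have A: "agree 33 R R0" using I by (simp add: I_def st)
    have Q: "R rQ = q" using agreeD[OF A, of rQ] q by simp
    have gR: "good R" using good_agree[OF A _ g] by simp
    have R: "R rV = 1" "R rW = R rR + d" "ok (R rR + d)" "R rR + d < q"
      using I lt Q by (auto simp: I_def st)
    have no: "\<not> periodic q d" if "pat (R rR) \<noteq> pat (R rR + d)"
      using that R(4) unfolding periodic_def by blast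
    show "wp A B body st (\<lambda>t s'. I s' \<and> t + f s' + 2 \<le> f st)"
    proof -
      have le: "R rR \<le> l" "R rR + d \<le> l" "R rR \<noteq> R rR + d" using R(4) q(2) d(2) by auto
      consider "pat (R rR) < pat (R rR + d)" | "pat (R rR + d) < pat (R rR)"
        | "pat (R rR) = pat (R rR + d)" by linarith
      then show ?thesis
      proof cases
        case 1
        then show ?thesis unfolding body_def st using A R(4) no
          by (simp add: wp_prims gR Q R(1,2) le split del: if_split) (simp add: I_def f_def R(2), (intro conjI impI; use R(4) in linarith))
      next
        case 2
        then show ?thesis unfolding body_def st using A R(4) no
          by (simp add: wp_prims gR Q R(1,2) le order_less_not_sym[OF 2] split del: if_split)
            (simp add: I_def f_def R(2), (intro conjI impI; use R(4) in linarith))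
      next
        case 3
        then have "pat (R rR) < pat (R rR + d) \<longleftrightarrow> False" "pat (R rR + d) < pat (R rR) \<longleftrightarrow> False" by simp_all
        then show ?thesis unfolding body_def st using A R(4) ok_Suc[OF R(3) 3]
          by (simp add: wp_prims gR Q R(1,2) le split del: if_split) (auto simp: I_def f_def R(1,2))
      qed
    qed
  qed
  show ?thesis unfolding verify_prog_def body_def[symmetric]
  proof (simp add: wp_prims g d R1_def[symmetric, simplified] split del: if_split, rule wp_mono[OF loop], goal_cases)
    case (1 t s')
    then obtain R where s': "s' = (R, sp)" by (auto simp: I_def)
    have A: "agree 33 R R0" using 1 by (simp add: I_def s')
    have Q: "R rQ = q" using agreeD[OF A, of rQ] q by simp
    have "R rV = (if periodic q d then 1 else 0)"
    proof (cases "R rV = 0")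
      case True
      then show ?thesis using 1 by (auto simp: I_def s')
    next
      case False
      then have "R rV = 1" "ok q" using 1 Q by (auto simp: I_def s')
      then show ?thesis using d(2) unfolding ok_def periodic_def by simp
    qed
    moreover have "t \<le> 30 * q + 2" using 1 by (auto simp: f_def s' R1_def)
    ultimately show ?case using A s' by auto
  qed
qed

lemma wp_period:
  assumes g: "good R0" and q: "R0 rQ = q" "q \<le> Suc l"
  shows "wp A B period_prog (R0, sp) (\<lambda>t s'. \<exists>R. s' = (R, sp) \<and> agree 32 R R0 \<and>
    (R rV = 0 \<and> (\<forall>d. 4 * d \<le> q \<longrightarrow> \<not> periodic q d) \<or> R rV = 1 \<and> minper q (R rD) \<and> 4 * R rD \<le> q) \<and>
    t \<le> 110 * q + 150)"
proof (cases "q < 4")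
  case True
  then have "\<not> periodic q d" if "4 * d \<le> q" for d using that by (auto simp: periodic_def)
  then show ?thesis unfolding period_prog_def using True q g by (auto simp: wp_prims)
next
  case False
  define R1 where "R1 = R0(rV := 0, rT := q div 4)"
  have R1: "good R1" "R1 rQ = q" "1 \<le> q" "R1 rT = q div 4" using g q False by (simp_all add: R1_def)
  have T: "0 < q div 4" using False by simp
  show ?thesis unfolding period_prog_def
  proof (simp add: goodD g q R1_def[symmetric], simp add: R1 T goodD, rule wp_mono[OF wp_duel[OF R1(1-3) q(2)]], goal_cases)
    case (1 t s')
    then obtain R i j ik jk where R: "s' = (R, sp)" "agree 40 R R1" "R rI = i" "R rJ = j"
      "duel q i j ik jk" "ik = q \<or> jk = q" "t \<le> 80 * q + 50" by blast
    define d where "d = (if i < j then j - i else i - j)"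
    have gR: "good R" using good_agree[OF R(2) _ R1(1)] by simp
    have v: "R rQ = q" "R rT = q div 4" "R rV = 0"
      using agreeD[OF R(2), of rQ] agreeD[OF R(2), of rT] agreeD[OF R(2), of rV] q by (simp_all add: R1_def)
    have A: "agree 32 R R0" using R(2) by (simp add: agree_def R1_def)
    have d: "0 < d" "\<And>u. minper q u \<Longrightarrow> 4 * u \<le> q \<Longrightarrow> u = d"
      using R(5) duel_end[OF R(5,6)] by (auto simp: d_def duel_def)
    \<comment> \<open>A period of length at most \<open>q / 4\<close> forces the shortest period to
      be \<open>d\<close>, so testing \<open>d\<close> alone decides whether any such period
      exists.\<close>
    have none: "\<not> periodic q u" if "\<not> (periodic q d \<and> 4 * d \<le> q)" "4 * u \<le> q" for u
    proof
      assume "periodic q u"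
      then obtain w where "w \<le> u" "minper q w" using minper_exists by blast
      then show False using that d(2)[of w] by (auto simp: minper_def)
    qed
    have min: "minper q d" if "periodic q d" "4 * d \<le> q"
    proof -
      obtain w where "w \<le> d" "minper q w" using minper_exists[OF \<open>periodic q d\<close>] by blast
      then show ?thesis using that d(2)[of w] by simp
    qed
    define R2 where "R2 = R(rD := d)"
    have R2: "good R2" "R2 rQ = q" "R2 rD = d" "R2 rT = q div 4" "R2 rV = 0" "agree 32 R2 R0" using A gR v by (simp_all add: R2_def)
    have eq: "wp A B dist_prog (R, sp) Q
      = Q (if i < j then 2 else 3) (R2, sp)" for Q
      using R(3,4) by (simp add: dist_prog_def R2_def d_def flip: numeral_2_eq_2)
    show ?case
    proof (cases "q div 4 < d")
      case True
      then have "\<not> 4 * d \<le> q" by linarith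
      with none have "\<forall>u. 4 * u \<le> q \<longrightarrow> \<not> periodic q u" by blast
      with True show ?thesis unfolding R(1) by (simp add: eq R2) (use R(7) in simp)
    next
      case False
      then have d4: "4 * d \<le> q" by linarith
      show ?thesis
        unfolding R(1)
      proof (simp add: eq R2 False split del: if_split,
          rule wp_mono[OF wp_verify[OF R2(1,2) q(2) R2(3) d(1)]], goal_cases)
        case 1
        then show ?case using d4 by simp
      next
        case (2 t' s'')
        then obtain R3 where R3: "s'' = (R3, sp)" "agree 33 R3 R2"
          "R3 rV = (if periodic q d then 1 else 0)" "t' \<le> 30 * q + 50" by auto
        have "R3 rD = d" using agreeD[OF R3(2), of rD] R2 by simp
        moreover have "agree 32 R3 R0"
          by (rule agree_trans[OF R3(2) R2(6)]) simp_all
        moreover have "(if i < j then 2 else 3) \<le> (3 :: nat)" by simp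
        then have "t + ((if i < j then 2 else 3) + t') \<le> 145 + 110 * q"
          using R3(4) R(7) by linarith
        ultimately show ?case using R3 none min d4 by auto
      qed
    qed
  qed
qed


text \<open>The time is charged to the part of the run beyond the match, which is no longer than the
  jump that follows.\<close>

lemma wp_reach:
  assumes g: "good R0" and e: "R0 rE = p + ext p" "p + ext p < n" and d: "R0 rD = d"
    and per: "minper (ext p) d" "4 * d \<le> ext p" and lt: "ext p < Suc l"
  shows "wp A B reach_prog (R0, sp) (\<lambda>t s'. \<exists>R. s' = (R, sp) \<and> agree 34 R R0 \<and>
    long_run p d (R rR) \<and> t \<le> 30 * (R rR - R rE) + 50)"
proof -
  define q where "q = ext p"
  define e0 where "e0 = p + q"
  have dq: "0 < d" "d < q" "periodic q d" using per by (auto simp: minper_def periodic_def q_def)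
  define I where "I = (\<lambda>(R, sp'). sp' = sp \<and> agree 34 R R0 \<and> e0 \<le> R rR \<and> R rR = R rW + d \<and>
     reaches p d (R rR) \<and>
     (R rLim = n \<or> R rLim = 0 \<and> R rR < n \<and> hay (R rR) \<noteq> hay (R rW)))"
  define f where "f = (\<lambda>(R :: nat \<Rightarrow> nat, sp' :: nat). 30 * (n - R rR) + (if R rLim = 0 then 0 else 30))"
  define body where "body = getT rR rX ;; getT rW rY ;;
     IfLess rX rY stop (IfLess rY rX stop (inc rR ;; inc rW))"
  define R1 where "R1 = R0(rR := e0, rW := e0 - d, rLim := n)"
  have loop: "wp A B (WhileLess rR rLim body) (R1, sp)
     (\<lambda>t s'. I s' \<and> \<not> fst s' rR < fst s' rLim \<and> t + f s' \<le> f (R1, sp) + 2)"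
  proof (rule wp_While)
    have "agrees p q" unfolding q_def using e by (intro agrees_ext) simp
    then have per_e: "hay (p + x) = hay (p + (x + d))" if "x + d < q" for x
      using that dq(3) by (auto simp: agrees_def periodic_def)
    have "hay x = hay (x + d)" if "p \<le> x" "x + d < e0" for x
      using that per_e[of "x - p"] by (simp add: e0_def)
    then show "I (R1, sp)" using e dq by (auto simp: I_def R1_def reaches_def e0_def q_def)
    fix st assume I: "I st" and lt: "fst st rR < fst st rLim"
    obtain R where st: "st = (R, sp)" using I by (auto simp: I_def)
    define r where "r = R rR"
    have R: "agree 34 R R0" "e0 \<le> r" "R rW = r - d" "reaches p d r" "r < n" "d \<le> r" "R rLim = n"
      using I lt by (auto simp: I_def st r_def)
    have gR: "good R" using good_agree[OF R(1) _ g] by simp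
    have nx: "reaches p d (Suc r)" if "hay r = hay (r - d)"
      unfolding reaches_def
    proof (intro conjI allI impI)
      fix x assume "p \<le> x" "x + d < Suc r"
      then show "hay x = hay (x + d)"
        using R(4) that by (cases "x + d = r") (auto simp: reaches_def)
    qed (use R(5) in simp)
    show "wp A B body st (\<lambda>t s'. I s' \<and> t + f s' + 2 \<le> f st)"
      using R gR nx dq unfolding body_def st
      by (auto simp: wp_prims I_def f_def Suc_diff_le simp flip: r_def)
  qed
  have init: "R0 31 - d = e0 - d" "R0 31 = e0" using e by (simp_all add: e0_def q_def)
  show ?thesis unfolding reach_prog_def body_def[symmetric]
  proof (simp add: wp_prims g init d R1_def[symmetric], rule wp_mono[OF loop], goal_cases)
    case (1 t s')
    then obtain R where s': "s' = (R, sp)" by (auto simp: I_def)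
    define r where "r = R rR"
    have R: "agree 34 R R0" "e0 \<le> r" "R rW = r - d" "reaches p d r" "r = n \<or> hay r \<noteq> hay (r - d)" "r \<le> n"
      using 1 by (auto simp: I_def s' r_def reaches_def)
    have "long_run p d r" unfolding long_run_def
      using R e per lt by (auto simp: e0_def q_def)
    moreover have "t + 30 * (n - r) \<le> 30 * (n - e0) + 32"
      using 1 e by (auto simp: f_def s' R1_def r_def e0_def q_def split: if_splits)
    then have "t \<le> 30 * (r - e0) + 32" using R(2,6) by linarith
    moreover have "R rE = e0" using agreeD[OF R(1), of rE] init by simp
    ultimately show ?case using R(1) s' by (auto simp: r_def)
  qed
qed

lemma wp_jump:
  assumes g: "good R0" and e: "R0 rQ = ext p" "R0 rE = p + ext p" "R0 rD = d" "R0 rR = r"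
    and run: "long_run p d r"
  shows "wp A B jump_prog (R0, sp) (\<lambda>t s'. \<exists>R. s' = (R, sp) \<and> agree 20 R R0 \<and>
    R rBP = R0 rBP \<and> R rBQ = R0 rBQ \<and>
    R rP = (if p + ext p < r \<and> d dvd r - ext p - p then r - ext p else r - ext p div 2) \<and> t \<le> 10)"
proof -
  define m where "m = (r - (p + ext p)) mod d"
  have m: "0 < m \<longleftrightarrow> \<not> d dvd r - ext p - p"
    by (simp add: m_def mod_greater_zero_iff_not_dvd add.commute)
  show ?thesis
  proof (cases "p + ext p < r")
    case True
    then show ?thesis unfolding jump_prog_def
      using g e m by (cases "0 < m") (simp_all add: goodD flip: m_def)
  next
    case False
    then show ?thesis unfolding jump_prog_def using g e by (simp add: goodD)
  qed
qed

section \<open>Soundness of the jumps and the total cost of a search\<close>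

definition advances :: "nat \<Rightarrow> nat \<Rightarrow> bool" where
  "advances p p' \<longleftrightarrow> p < p' \<and> p' \<le> n \<and> (\<forall>x. p < x \<and> x < p' \<longrightarrow> ext x \<le> ext p) \<and>
     ext p + weight p \<le> 12 * (p' - p) + weight p'"

text \<open>A full match cannot be exceeded, and a match up to the end of the text leaves less room
  for every later one.\<close>

lemma advances_stop:
  assumes "p < n" "ext p = Suc l \<or> p + ext p = n"
  shows "advances p n"
proof -
  have "ext x \<le> ext p" if "p < x" "x < n" for x
    using agrees_ext[of x] that assms(2) by (auto simp: agrees_def)
  moreover have "ext p \<le> 4 * (n - p)" using ext_le[of p] assms(1) by linarith
  ultimately show ?thesis using assms(1) weight_long[of p n] by (simp add: advances_def)
qed

lemma advances_aperiodic:
  assumes "p + ext p < n" "\<And>t. 4 * t \<le> ext p \<Longrightarrow> \<not> periodic (ext p) t"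
  shows "advances p (p + ext p div 4 + 1)"
proof -
  have "ext x \<le> ext p" if "p < x" "x < p + ext p div 4 + 1" for x
    using skip_aperiodic[OF that(1) _ _ assms(2)] that assms(1) by simp
  moreover have "ext p \<le> 4 * (p + ext p div 4 + 1 - p)" by simp
  moreover have "p + ext p div 4 + 1 \<le> n" using assms(1) by linarith
  ultimately show ?thesis using weight_long[of p "p + ext p div 4 + 1"] by (simp add: advances_def)
qed

lemma advances_run:
  assumes run: "long_run p t r"
  shows "advances p (if p + ext p < r \<and> t dvd r - ext p - p then r - ext p else r - ext p div 2)"
proof -
  have r: "p + ext p \<le> r" "r \<le> n" "0 < t" "4 * t \<le> ext p"
    using run by (auto simp: long_run_def reaches_def minper_def periodic_def)
  show ?thesis
  proof (cases "p + ext p < r \<and> t dvd r - ext p - p")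
    case True
    have "ext x \<le> ext p" if "p < x" "x < r - ext p" for x
      using that by (intro skip_run[OF run]) auto
    moreover have "ext p + weight p \<le> weight (r - ext p)" using weight_short[OF run] True by simp
    moreover have "p < r - ext p" using True by linarith
    ultimately show ?thesis using True r by (simp add: advances_def)
  next
    case False
    have "ext x \<le> ext p" if "p < x" "x < r - ext p div 2" for x
    proof (rule skip_run[OF run that(1)])
      \<comment> \<open>In this case \<open>x > p\<close> forces the run to pass the match end, so
        the divisibility is what failed.\<close>
      show "\<not> t dvd x - p" if "x + ext p = r"
        using False \<open>p < x\<close> that by auto
    qed (use that in simp)
    moreover have "ext p \<le> 4 * (r - ext p div 2 - p)" "p < r - ext p div 2" using r by linarith+
    moreover have "r - ext p div 2 \<le> n" using r by linarith
    ultimately show ?thesis unfolding if_not_P[OF False]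
      using weight_long[of p "r - ext p div 2"] by (simp add: advances_def)
  qed
qed

lemma wp_advance:
  assumes g: "good R0" and e: "R0 rP = p" "R0 rQ = ext p" "R0 rE = p + ext p" and p: "p < n"
  shows "wp A B advance_prog (R0, sp) (\<lambda>t s'. \<exists>R. s' = (R, sp) \<and> agree 20 R R0 \<and>
    R rBP = R0 rBP \<and> R rBQ = R0 rBQ \<and> advances p (R rP) \<and> t \<le> 110 * ext p + 30 * (R rP - p) + 240)"
proof (cases "ext p < Suc l \<and> p + ext p < n")
  case False
  then have "advances p n"
    using p ext_le[of p] agrees_ext[of p] by (intro advances_stop) (auto simp: agrees_def)
  then show ?thesis using False e g by (auto simp: advance_prog_def goodD wp_mov)
next
  case True
  have le: "ext p \<le> Suc l" using True by simp
  show ?thesis unfolding advance_prog_def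
  proof (simp add: True e goodD[OF g], rule wp_mono[OF wp_period[OF g e(2) le]], goal_cases)
    case (1 t s')
    then obtain R where R: "s' = (R, sp)" "agree 32 R R0" "t \<le> 110 * ext p + 150"
      and cs: "R rV = 0 \<and> (\<forall>d. 4 * d \<le> ext p \<longrightarrow> \<not> periodic (ext p) d) \<or>
        R rV = 1 \<and> minper (ext p) (R rD) \<and> 4 * R rD \<le> ext p" by blast
    have gR: "good R" using good_agree[OF R(2) _ g] by simp
    have A: "agree 20 R R0" using R(2) by (simp add: agree_def)
    have v: "R rQ = ext p" "R rE = p + ext p" "R rBP = R0 rBP" "R rBQ = R0 rBQ"
      using agreeD[OF R(2)] e by simp_all
    show ?case
    proof (cases "R rV = 0")
      case True
      then have "advances p (p + ext p div 4 + 1)"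
        using cs \<open>_ \<and> p + ext p < n\<close> by (intro advances_aperiodic) auto
      moreover have "Suc (p + ext p) - (ext p - ext p div 4) = p + ext p div 4 + 1" by simp
      ultimately show ?thesis using True R(3) A unfolding R(1)
        by (simp add: goodD gR wp_inc v)
    next
      case False
      then have cs: "R rV = 1" "minper (ext p) (R rD)" "4 * R rD \<le> ext p" using cs by auto
      have pn: "p + ext p < n" "ext p < Suc l" using True by simp_all
      show ?thesis unfolding R(1)
      proof (simp add: goodD gR cs(1), rule wp_mono[OF wp_reach[OF gR v(2) pn(1) refl cs(2,3) pn(2)]], goal_cases)
        case (1 t' s'')
        then obtain R' where R': "s'' = (R', sp)" "agree 34 R' R" "long_run p (R rD) (R' rR)"
          "t' \<le> 30 * (R' rR - R' rE) + 50" by blast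
        have gR': "good R'" using good_agree[OF R'(2) _ gR] by simp
        have v': "R' rQ = ext p" "R' rE = p + ext p" "R' rD = R rD" "R' rBP = R0 rBP" "R' rBQ = R0 rBQ"
          using agreeD[OF R'(2)] v by simp_all
        show ?case unfolding R'(1)
        proof (rule wp_mono[OF wp_jump[OF gR' v'(1-3) refl R'(3)]], goal_cases)
          case (1 t'' s''')
          then obtain R'' where R'': "s''' = (R'', sp)" "agree 20 R'' R'" "R'' rBP = R' rBP" "R'' rBQ = R' rBQ"
            "R'' rP = (if p + ext p < R' rR \<and> R rD dvd R' rR - ext p - p then R' rR - ext p
              else R' rR - ext p div 2)" "t'' \<le> 10" by blast
          have "advances p (R'' rP)" unfolding R''(5) by (rule advances_run[OF R'(3)])
          moreover have "agree 20 R'' R0"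
            using agree_trans[OF agree_trans[OF R''(2) R'(2), of 20] A, of 20] by simp
          moreover have "R' rR - R' rE \<le> R'' rP - p" unfolding R''(5) v'(2) by auto
          ultimately show ?case using R'' v' R(3) R'(4) by auto
        qed
      qed
    qed
  qed
qed

lemma wp_iter:
  assumes g: "good R0" and p: "R0 rP = p" "p < n"
  shows "wp A B iter_prog (R0, sp) (\<lambda>t s'. \<exists>R. s' = (R, sp) \<and> agree 20 R R0 \<and>
    advances p (R rP) \<and> R rBQ = max (R0 rBQ) (ext p) \<and>
    R rBP = (if R0 rBQ < ext p then p else R0 rBP) \<and> t + 2 \<le> 400 * (ext p + (R rP - p)))"
  unfolding iter_prog_def
proof (simp split del: if_split, rule wp_mono[OF wp_lcp[OF g p]], goal_cases)
  case (1 t s')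
  then obtain R where R: "s' = (R, sp)" "agree 30 R R0" "R rQ = ext p" "R rE = p + ext p"
    "t \<le> 30 * ext p + 40" by blast
  have gR: "good R" using good_agree[OF R(2) _ g] by simp
  have v: "R rP = p" "R rBQ = R0 rBQ" "R rBP = R0 rBP" using agreeD[OF R(2)] p by simp_all
  have A: "agree 20 R R0" using R(2) by (simp add: agree_def)
  define R1 where "R1 = R(rBQ := max (R0 rBQ) (ext p), rBP := (if R0 rBQ < ext p then p else R0 rBP))"
  have "wp A B update_prog (R, sp) (\<lambda>t s'. t \<le> 3 \<and> s' = (R1, sp))"
  proof (cases "R0 rBQ < ext p")
    case True
    then show ?thesis using R v by (simp add: update_prog_def wp_mov gR R1_def max_def)
  next
    case False
    then have "R1 = R" using v by (auto simp: R1_def)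
    then show ?thesis using R v False by (simp add: update_prog_def)
  qed
  then show ?case unfolding R(1)
  proof (rule wp_mono, goal_cases)
    case (1 t' s'')
    have R1: "good R1" "R1 rP = p" "R1 rQ = ext p" "R1 rE = p + ext p" "agree 20 R1 R0"
      using gR v R A by (simp_all add: R1_def)
    have s'': "s'' = (R1, sp)" "t' \<le> 3" using 1 by auto
    show ?case unfolding s''
    proof (rule wp_mono[OF wp_advance[OF R1(1-4) p(2)]], goal_cases)
      case (1 t'' s''')
      then obtain R2 where R2: "s''' = (R2, sp)" "agree 20 R2 R1" "R2 rBP = R1 rBP" "R2 rBQ = R1 rBQ"
        "advances p (R2 rP)" "t'' \<le> 110 * ext p + 30 * (R2 rP - p) + 240" by blast
      have "p < R2 rP" using R2(5) by (simp add: advances_def)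
      \<comment> \<open>A jump has length at least one, which absorbs all additive
        constants.\<close>
      then obtain d where d: "R2 rP - p = Suc d" by (metis Suc_diff_Suc)
      have "t + (t' + t'') + 2 \<le> 400 * (ext p + (R2 rP - p))"
        using R2(6) R(5) s''(2) unfolding d by simp
      moreover have "agree 20 R2 R0" using agree_trans[OF R2(2) R1(5)] by simp
      ultimately show ?case using R2 by (auto simp: R1_def)
    qed
  qed
qed

lemma wp_search:
  assumes g: "good R0"
  shows "wp A B search_prog (R0, sp) (\<lambda>t s'. \<exists>R. s' = (R, sp) \<and> agree 20 R R0 \<and>
    agrees (R rBP) (R rBQ) \<and> (\<forall>x q. agrees x q \<longrightarrow> q \<le> R rBQ) \<and> t \<le> 5200 * n + 10)"
proof -
  define I where "I = (\<lambda>(R, sp'). sp' = sp \<and> agree 20 R R0 \<and> R rP \<le> n \<and>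
     agrees (R rBP) (R rBQ) \<and> (\<forall>x < R rP. ext x \<le> R rBQ))"
  \<comment> \<open>By \<open>advances\<close>, the drop of \<open>13 * (n - p) - weight p\<close>
    covers the match length plus the jump length. By \<open>weight_le\<close>, the subtraction is
    never truncated.\<close>
  define f where "f = (\<lambda>(R :: nat \<Rightarrow> nat, sp' :: nat). 400 * (13 * (n - R rP) - weight (R rP)))"
  define R1 where "R1 = R0(rP := 0, rBQ := 0, rBP := 0)"
  have loop: "wp A B (WhileLess rP rN iter_prog) (R1, sp)
     (\<lambda>t s'. I s' \<and> \<not> fst s' rP < fst s' rN \<and> t + f s' \<le> f (R1, sp) + 2)"
  proof (rule wp_While)
    show "I (R1, sp)" by (auto simp: I_def R1_def agrees_def)
    fix st assume I: "I st" and lt: "fst st rP < fst st rN"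
    obtain R where st: "st = (R, sp)" using I by (auto simp: I_def)
    define p where "p = R rP"
    have R: "agree 20 R R0" "agrees (R rBP) (R rBQ)" "\<And>x. x < p \<Longrightarrow> ext x \<le> R rBQ"
      using I by (auto simp: I_def st p_def)
    have gR: "good R" using good_agree[OF R(1) _ g] by simp
    have p: "p < n" using lt goodD[OF gR] by (simp add: st p_def)
    show "wp A B iter_prog st (\<lambda>t s'. I s' \<and> t + f s' + 2 \<le> f st)" unfolding st
    proof (rule wp_mono[OF wp_iter[OF gR p_def[symmetric] p]], goal_cases)
      case (1 t s')
      then obtain R' where R': "s' = (R', sp)" "agree 20 R' R" "advances p (R' rP)"
        "R' rBQ = max (R rBQ) (ext p)" "R' rBP = (if R rBQ < ext p then p else R rBP)"
        "t + 2 \<le> 400 * (ext p + (R' rP - p))" by blast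
      define p' where "p' = R' rP"
      have adv: "p < p'" "p' \<le> n" "\<And>x. p < x \<Longrightarrow> x < p' \<Longrightarrow> ext x \<le> ext p"
        "ext p + weight p \<le> 12 * (p' - p) + weight p'"
        using R'(3) by (auto simp: advances_def p'_def)
      have "ext x \<le> R' rBQ" if "x < p'" for x
        using R(3)[of x] adv(3)[of x] that unfolding R'(4) by (cases x p rule: linorder_cases) auto
      moreover have "agrees (R' rBP) (R' rBQ)"
        using R(2) agrees_ext[of p] p unfolding R'(4,5) by (auto simp: max_def)
      moreover have "agree 20 R' R0" using agree_trans[OF R'(2) R(1)] by simp
      ultimately have "I s'" using adv by (simp add: I_def R'(1) p'_def)
      moreover have "t + 2 + 400 * (13 * (n - p') - weight p') \<le> 400 * (13 * (n - p) - weight p)"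
      proof -
        have "ext p + (p' - p) + (13 * (n - p') - weight p') \<le> 13 * (n - p) - weight p"
          using adv(1,2,4) weight_le[of p'] weight_le[of p] by linarith
        then have "400 * (ext p + (p' - p)) + 400 * (13 * (n - p') - weight p') \<le> 400 * (13 * (n - p) - weight p)"
          unfolding add_mult_distrib2[symmetric] by (rule mult_le_mono2)
        then show ?thesis using R'(6) by (simp add: p'_def)
      qed
      ultimately show ?case by (simp add: f_def R'(1) p'_def p_def)
    qed
  qed
  show ?thesis unfolding search_prog_def
  proof (simp add: R1_def[symmetric], rule wp_mono[OF loop], goal_cases)
    case (1 t s')
    then obtain R where s': "s' = (R, sp)" by (auto simp: I_def)
    have R: "agree 20 R R0" "agrees (R rBP) (R rBQ)" "R rP \<le> n" "\<And>x. x < R rP \<Longrightarrow> ext x \<le> R rBQ"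
      using 1 by (auto simp: I_def s')
    have "R rP = n" using 1 R(3) goodD[OF good_agree[OF R(1) _ g]] by (simp add: s')
    then have "q \<le> R rBQ" if "agrees x q" for x q
      using that R(4)[of x] ext_greatest[OF that] by (cases "x < n") (auto simp: agrees_def)
    moreover have "f (R1, sp) \<le> 5200 * n" by (simp add: f_def R1_def)
    then have "t \<le> 5200 * n + 2" using 1 by linarith
    ultimately show ?case using R s' by auto
  qed
qed

end

section \<open>From matches against the stream to the longest common substring\<close>

text \<open>The \<^term>\<open>q\<close> characters of the reversed \<^term>\<open>A\<close> from position \<^term>\<open>p\<close> on are the last
  \<^term>\<open>q\<close> of the first \<^term>\<open>j\<close> characters of \<^term>\<open>B\<close>, read backwards.\<close>
definition matches :: "nat list \<Rightarrow> nat list \<Rightarrow> nat \<Rightarrow> nat \<Rightarrow> nat \<Rightarrow> bool" where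
  "matches A B p q j \<longleftrightarrow> p + q \<le> length A \<and> q \<le> j \<and>
     (\<forall>k<q. A ! (length A - 1 - (p + k)) = B ! (j - 1 - k))"

definition longest :: "nat list \<Rightarrow> nat list \<Rightarrow> nat \<Rightarrow> nat \<Rightarrow> nat \<Rightarrow> bool" where
  "longest A B s l j \<longleftrightarrow> matches A B s l j \<and> (\<forall>p q. matches A B p q j \<longrightarrow> q \<le> l)"

definition best :: "nat list \<Rightarrow> nat list \<Rightarrow> nat \<Rightarrow> nat \<Rightarrow> bool" where
  "best A B g j \<longleftrightarrow> (\<exists>p. \<exists>i\<le>j. matches A B p g i) \<and> (\<forall>p q. \<forall>i\<le>j. matches A B p q i \<longrightarrow> q \<le> g)"

lemma longest_0: "longest A B 0 0 0"
  by (auto simp: longest_def matches_def)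

lemma best_0: "best A B 0 0"
  by (auto simp: best_def matches_def)

lemma best_Suc:
  assumes "best A B g j" "longest A B s l (Suc j)"
  shows "best A B (if g < l then l else g) (Suc j)"
proof -
  obtain p i where "i \<le> j" "matches A B p g i" using assms(1) by (auto simp: best_def)
  moreover have "q \<le> (if g < l then l else g)" if "i \<le> Suc j" "matches A B p q i" for p q i
  proof (cases "i = Suc j")
    case True
    then have "q \<le> l" using assms(2) that by (auto simp: longest_def)
    then show ?thesis by simp
  next
    case False
    then have "i \<le> j" using that(1) by simp
    then have "q \<le> g" using assms(1) that(2) unfolding best_def by blast
    then show ?thesis by simp
  qed
  moreover have "matches A B s l (Suc j)" using assms(2) by (simp add: longest_def)
  ultimately show ?thesis unfolding best_def by (auto intro: le_SucI)
qed

text \<open>Dropping the newest character from a match leaves a match for the stream before it, at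
  the next position of the reversed text. Hence no match is longer than \<open>l + 1\<close>, and
  all of them are matches of prefixes of the pattern.\<close>

lemma (in round) matches_iff_agrees:
  assumes "longest A B s l j" "c = B ! j"
  shows "matches A B p q (Suc j) \<longleftrightarrow> agrees p q"
proof -
  have sl': "s + l \<le> n" "l \<le> j" "\<And>k. k < l \<Longrightarrow> A ! (n - 1 - (s + k)) = B ! (j - 1 - k)"
    using assms(1) by (auto simp: longest_def matches_def)
  have pat: "pat k = B ! (j - k)" if "k \<le> l" for k
    unfolding pat_def using assms(2) sl'(3)[of "k - 1"] that by (cases k) simp_all
  have le: "q \<le> Suc l" if m: "matches A B p q (Suc j)"
  proof (cases q)
    case (Suc q')
    have "matches A B (Suc p) q' j" unfolding matches_def
    proof (intro conjI allI impI)
      fix k assume "k < q'"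
      then have "A ! (n - 1 - (p + Suc k)) = B ! (Suc j - 1 - Suc k)"
        using m Suc by (auto simp: matches_def)
      then show "A ! (n - 1 - (Suc p + k)) = B ! (j - 1 - k)" by simp
    qed (use m Suc in \<open>simp_all add: matches_def\<close>)
    then show ?thesis using assms(1) Suc by (auto simp: longest_def)
  qed simp
  have "pat k = hay (p + k) \<longleftrightarrow> A ! (n - 1 - (p + k)) = B ! (Suc j - 1 - k)" if "k < q" "q \<le> Suc l" for k
    using pat[of k] that by (auto simp: hay_def)
  then show ?thesis using le sl'(2) by (auto simp: matches_def agrees_def)
qed

lemma best_lcs_len:
  assumes "best A B g (length B)"
  shows "lcs_len A B = g"
  unfolding lcs_len_def
proof (rule Max_eqI)
  have "{length s |s. sublist s A \<and> sublist s B} \<subseteq> {..length A}"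
    using sublist_length_le by auto
  then show "finite {length s |s. sublist s A \<and> sublist s B}" by (rule finite_subset) simp
next
  fix y assume "y \<in> {length s |s. sublist s A \<and> sublist s B}"
  then obtain s a1 a2 b1 b2 where s: "y = length s" "A = a1 @ s @ a2" "B = b1 @ s @ b2"
    by (auto simp: sublist_def)
  \<comment> \<open>Read backwards, the occurrence of \<open>s\<close> starts after the reversed
    \<open>a2\<close>, and in the stream it ends after \<open>b1 @ s\<close>.\<close>
  have "matches A B (length a2) y (length b1 + y)" unfolding matches_def
  proof (intro conjI allI impI)
    fix k assume k: "k < y"
    define i where "i = y - 1 - k"
    have i: "i < length s" using k s(1) by (simp add: i_def)
    have "length A - 1 - (length a2 + k) = length a1 + i" using k s(1) by (simp add: s(2) i_def)
    then have "A ! (length A - 1 - (length a2 + k)) = s ! i" using i by (simp add: s(2) nth_append)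
    also have "\<dots> = B ! (length b1 + i)" using i by (simp add: s(3) nth_append)
    also have "length b1 + i = length b1 + y - 1 - k" using k by (simp add: i_def)
    finally show "A ! (length A - 1 - (length a2 + k)) = B ! (length b1 + y - 1 - k)" .
  qed (simp_all add: s)
  moreover have "length b1 + y \<le> length B" by (simp add: s)
  ultimately show "y \<le> g" using assms unfolding best_def by blast
next
  obtain p i where i: "i \<le> length B" and m: "matches A B p g i" using assms by (auto simp: best_def)
  \<comment> \<open>Undoing the reversal: a match at \<open>p\<close> of the reversed text begins at
    \<open>length A - p - g\<close> in \<open>A\<close>.\<close>
  define u where "u = take g (drop (length A - p - g) A)"
  define v where "v = take g (drop (i - g) B)"
  have l: "length u = g" "length v = g" using m i by (auto simp: u_def v_def matches_def)
  have "u = v"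
  proof (rule nth_equalityI)
    fix k assume "k < length u"
    then have k: "k < g" by (simp add: l)
    have "g - 1 - k < g" using k by simp
    then have "A ! (length A - 1 - (p + (g - 1 - k))) = B ! (i - 1 - (g - 1 - k))"
      using m unfolding matches_def by blast
    moreover have "length A - 1 - (p + (g - 1 - k)) = length A - p - g + k"
      using m k by (simp add: matches_def)
    moreover have "i - 1 - (g - 1 - k) = i - g + k" using m k by (simp add: matches_def)
    ultimately have "A ! (length A - p - g + k) = B ! (i - g + k)" by metis
    moreover have "u ! k = A ! (length A - p - g + k)" using k m by (simp add: u_def matches_def)
    moreover have "v ! k = B ! (i - g + k)" using k m i by (simp add: v_def matches_def)
    ultimately show "u ! k = v ! k" by (simp only:)
  qed (simp add: l)
  moreover have "sublist u A" "sublist v B"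
    unfolding u_def v_def by (meson sublist_take sublist_drop sublist_order.order_trans)+
  ultimately show "g \<in> {length s |s. sublist s A \<and> sublist s B}" using l by auto
qed

section \<open>The whole program on the stream\<close>

lemma wp_main:
  "wp A B main_prog ((\<lambda>_. 0), 0) (\<lambda>t s'. fst s' rG = lcs_len A B \<and>
     t \<le> 6000 * (length A + 1) * (length B + 1))"
proof -
  let ?n = "length A" and ?m = "length B"
  define ready :: "(nat \<Rightarrow> nat) \<Rightarrow> bool" where
    "ready R \<longleftrightarrow> R rZ = 0 \<and> R rU = 1 \<and> R rTwo = 2 \<and> R rFour = 4 \<and> R rN = ?n \<and> R rN1 = ?n - 1" for R
  \<comment> \<open>While \<open>rF\<close> is 1, the last character read is still unprocessed, so
    the records refer to the first \<open>sp - 1\<close> characters.\<close>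
  define I where "I = (\<lambda>(R, sp). ready R \<and>
     (R rF = 1 \<and> 0 < sp \<and> sp \<le> ?m \<and> R rC = B ! (sp - 1) \<and> longest A B (R rS) (R rL) (sp - 1) \<and>
        best A B (R rG) (sp - 1) \<or>
      R rF = 0 \<and> best A B (R rG) ?m))"
  \<comment> \<open>The factor \<open>m + 1 - sp\<close> counts the unprocessed characters,
    including the buffered one. Each pays for its search and the constant work around it.\<close>
  define f where "f = (\<lambda>(R :: nat \<Rightarrow> nat, sp :: nat). if R rF = 0 then 0 else (5200 * ?n + 50) * (?m + 1 - sp))"
  define body where "body = Bas (Add rLP rL rU) ;; search_prog ;; mov rS rBP ;; mov rL rBQ ;;
        record_prog ;; Bas (ReadB rC rF)"
  define R1 where "R1 = (\<lambda>_. 0 :: nat)(rU := 1, rTwo := 2, rFour := 4, rN := ?n, rN1 := ?n - 1)"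
  define R2 where "R2 = (if 0 < ?m then R1(rC := B ! 0, rF := 1) else R1(rF := 0))"
  define sp where "sp = (if 0 < ?m then 1 else 0 :: nat)"
  have loop: "wp A B (WhileLess rZ rF body) (R2, sp)
     (\<lambda>t s'. I s' \<and> \<not> fst s' rZ < fst s' rF \<and> t + f s' \<le> f (R2, sp) + 2)"
  proof (rule wp_While)
    show "I (R2, sp)"
      using longest_0 best_0 by (auto simp: I_def R2_def R1_def sp_def ready_def Suc_le_eq)
    fix st assume I: "I st" and lt: "fst st rZ < fst st rF"
    obtain R p where st: "st = (R, p)" by (cases st)
    define j where "j = p - 1"
    have R: "ready R" "R rF = 1" "p = Suc j" "j < ?m" "R rC = B ! j"
      "longest A B (R rS) (R rL) j" "best A B (R rG) j"
      using I lt by (auto simp: I_def st ready_def j_def)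
    interpret round A B "R rS" "R rL" "R rC"
      using R(6) by unfold_locales (simp add: longest_def matches_def)
    define R' where "R' = R(rLP := Suc (R rL))"
    have g: "good R'" using R(1) by (simp add: good_def ready_def R'_def)
    show "wp A B body st (\<lambda>t s'. I s' \<and> t + f s' + 2 \<le> f st)"
      unfolding body_def st R(3)
    proof (simp add: R(1)[unfolded ready_def] R'_def[symmetric] split del: if_split,
        rule wp_mono[OF wp_search[OF g]], goal_cases)
      case (1 t s')
      then obtain S where S: "s' = (S, Suc j)" "agree 20 S R'" "agrees (S rBP) (S rBQ)"
        "\<And>x q. agrees x q \<Longrightarrow> q \<le> S rBQ" "t \<le> 5200 * ?n + 10" by blast
      have gS: "good S" using good_agree[OF S(2) _ g] by simp
      have v: "S rG = R rG" using agreeD[OF S(2), of rG] by (simp add: R'_def)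
      have L: "longest A B (S rBP) (S rBQ) (Suc j)"
        unfolding longest_def matches_iff_agrees[OF R(6,5)] using S(3,4) by blast
      have b: "best A B (if R rG < S rBQ then S rBQ else R rG) (Suc j)"
        by (rule best_Suc[OF R(7) L])
      define S' where "S' = S(rS := S rBP, rL := S rBQ, rG := (if R rG < S rBQ then S rBQ else R rG))"
      have S': "ready S'" "longest A B (S' rS) (S' rL) (Suc j)" "best A B (S' rG) (Suc j)"
        using gS L b by (simp_all add: S'_def good_def ready_def)
      define E where "E = effect A B (ReadB rC rF) (S', Suc j)"
      have E: "I E \<and> t + 20 + f E \<le> f (R, Suc j)"
      proof (cases "Suc j < ?m")
        case True
        then have "?m + 1 - Suc j = Suc (?m + 1 - Suc (Suc j))" by simp
        then have "(5200 * ?n + 50) * (?m + 1 - Suc j) = (5200 * ?n + 50) * (?m + 1 - Suc (Suc j)) + (5200 * ?n + 50)"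
          by (metis mult_Suc_right add.commute)
        then show ?thesis using True S' S(5) R(2) by (simp add: E_def I_def f_def ready_def)
      next
        case False
        then have "Suc j = ?m" using R(4) by simp
        then show ?thesis using S' S(5) R(2) by (simp add: E_def I_def f_def ready_def)
      qed
      have up: "wp A B record_prog (S(rS := S rBP, rL := S rBQ), Suc j)
          (\<lambda>t s'. t \<le> 2 \<and> s' = (S', Suc j))"
        using gS v by (auto simp: record_prog_def mov_def good_def S'_def)
      have movs: "wp A B (mov rS rBP) (S, Suc j) Q = Q 1 (S(rS := S rBP), Suc j)"
        "wp A B (mov rL rBQ) (S(rS := S rBP), Suc j) Q = Q 1 (S(rS := S rBP, rL := S rBQ), Suc j)" for Q
        using gS by (simp_all add: mov_def good_def)
      show ?case unfolding S(1)
        by (simp only: movs, rule wp_mono[OF up], use E in \<open>auto simp del: effect.simps(9) simp flip: E_def\<close>)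
    qed
  qed
  have len: "6000 * (?n + 1) * (?m + 1) \<ge> (5200 * ?n + 50) * ?m + 20"
  proof -
    have "(5200 * ?n + 50) * ?m \<le> 5200 * (?n + 1) * (?m + 1)" by (rule mult_le_mono) simp_all
    moreover have "800 * (?n + 1) * (?m + 1) \<ge> 20" by simp
    ultimately show ?thesis by (simp add: algebra_simps)
  qed
  have read: "effect A B (ReadB rC rF)
      ((\<lambda>_. 0)(rU := Suc 0, rTwo := 2, rFour := 4, rN := ?n, rN1 := ?n - Suc 0), 0) = (R2, sp)"
    by (simp add: R2_def R1_def sp_def)
  show ?thesis unfolding main_prog_def body_def[symmetric]
  proof (simp add: read del: effect.simps(9), rule wp_mono[OF loop], goal_cases)
    case (1 t s')
    then obtain R p where s': "s' = (R, p)" by (cases s')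
    have R: "ready R" "R rF = 0" "best A B (R rG) ?m" using 1 by (auto simp: I_def ready_def s')
    have "f (R2, sp) \<le> (5200 * ?n + 50) * ?m" by (auto simp: f_def R2_def sp_def)
    then have "t + 8 \<le> 6000 * (?n + 1) * (?m + 1)" using 1 len by linarith
    then show ?case using best_lcs_len[OF R(3)] by (simp add: s' algebra_simps)
  qed
qed

section \<open>The compiled program, its running time and its word size\<close>

definition lcs_program :: "instr list" where
  "lcs_program = compile 0 main_prog @ [Halt rG]"

lemmas prog_defs = main_prog_def record_prog_def search_prog_def iter_prog_def advance_prog_def update_prog_def
  jump_prog_def reach_prog_def period_prog_def dist_prog_def verify_prog_def duel_prog_def bump_def
  lcp_prog_def getP_def getT_def mov_def inc_def stop_def

lemma main_basics: "i \<in> basics main_prog \<Longrightarrow> basic i \<and> tame rU i"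
  by (auto simp: prog_defs)

lemma lcs_program_tame: "\<forall>i \<in> set lcs_program. tame rU i"
proof
  fix i assume "i \<in> set lcs_program"
  then have "i = Halt rG \<or> i \<in> basics main_prog \<or> (\<exists>a b k. i = Jlt a b k) \<or> (\<exists>k. i = Jmp k)"
    using comp_set[of i 0 main_prog] by (auto simp: lcs_program_def)
  then show "tame rU i" using main_basics by auto
qed

text \<open>A halted configuration is a fixed point of the step function, so the result persists for
  every larger time bound.\<close>

lemma lcs_program_run:
  obtains T where "T \<le> 6001 * (length A + 1) * (length B + 1)"
    and "\<And>k. T \<le> k \<Longrightarrow> (dstep lcs_program A B ^^ k) init_cfg = (dstep lcs_program A B ^^ T) init_cfg"
    and "result ((dstep lcs_program A B ^^ T) init_cfg) = Some (lcs_len A B)"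
proof -
  let ?f = "dstep lcs_program A B"
  obtain t s where s: "big A B main_prog ((\<lambda>_. 0), 0) t s" "fst s rG = lcs_len A B"
    "t \<le> 6000 * (length A + 1) * (length B + 1)"
    using wp_main[of A B] unfolding wp_def by blast
  have init: "init_cfg = conf 0 ((\<lambda>_. 0), 0)" by (simp add: init_cfg_def conf_def)
  let ?c = "conf (length (compile 0 main_prog)) s"
  have "(?f ^^ t) init_cfg = ?c"
    using comp_correct[OF s(1), of lcs_program "[]" "[Halt rG]"] main_basics
    by (simp add: init lcs_program_def)
  moreover have "?f ?c = ?c\<lparr>result := Some (lcs_len A B)\<rparr>"
    by (simp add: dstep_def conf_def lcs_program_def s(2))
  ultimately have T: "(?f ^^ Suc t) init_cfg = ?c\<lparr>result := Some (lcs_len A B)\<rparr>" by simp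
  have fix_pt: "?f (?c\<lparr>result := Some (lcs_len A B)\<rparr>) = ?c\<lparr>result := Some (lcs_len A B)\<rparr>"
    by (simp add: dstep_def)
  have "(?f ^^ (d + Suc t)) init_cfg = (?f ^^ Suc t) init_cfg" for d
    by (induction d) (use T fix_pt in simp_all)
  then have "(?f ^^ k) init_cfg = (?f ^^ Suc t) init_cfg" if "Suc t \<le> k" for k
    by (metis le_add_diff_inverse2 that)
  moreover have "Suc t \<le> 6001 * (length A + 1) * (length B + 1)" using s(3) by (simp add: algebra_simps)
  ultimately show ?thesis using T that[of "Suc t"] by simp
qed

theorem theorem4:
  shows "\<forall>d::nat. \<exists>(P::instr list) (c::nat). \<forall>A B :: nat list.
     (\<forall>x \<in> set A \<union> set B. x < (length A + length B + 2) ^ d) \<longrightarrow>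
     (let n = length A; m = length B;
          T = c * (n + 1) * (m + 1) * (nat \<lceil>log 2 (real (n + m + 2))\<rceil>) ^ c
      in (\<forall>k \<le> T. \<forall>s \<in> set_pmf (run P A B k). \<forall>r. regs s r < (n + m + 2) ^ c)
       \<and> (\<forall>s \<in> set_pmf (run P A B T). result s \<noteq> None)
       \<and> measure_pmf.prob (run P A B T) {s. result s = Some (lcs_len A B)}
           \<ge> 1 - real n powr (-5))"
proof
  fix d :: nat
  \<comment> \<open>The factor must be at least 6001 for the running time, and the exponent must be
    \<open>6003 + (d + 2)\<close> for the register bound.\<close>
  define c where "c = d + 6005"
  show "\<exists>P c. \<forall>A B :: nat list.
     (\<forall>x \<in> set A \<union> set B. x < (length A + length B + 2) ^ d) \<longrightarrow>
     (let n = length A; m = length B;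
          T = c * (n + 1) * (m + 1) * (nat \<lceil>log 2 (real (n + m + 2))\<rceil>) ^ c
      in (\<forall>k \<le> T. \<forall>s \<in> set_pmf (run P A B k). \<forall>r. regs s r < (n + m + 2) ^ c)
       \<and> (\<forall>s \<in> set_pmf (run P A B T). result s \<noteq> None)
       \<and> measure_pmf.prob (run P A B T) {s. result s = Some (lcs_len A B)}
           \<ge> 1 - real n powr (-5))"
  proof (intro exI[of _ lcs_program] exI[of _ c] allI impI)
    fix A B :: "nat list"
    assume small: "\<forall>x \<in> set A \<union> set B. x < (length A + length B + 2) ^ d"
    let ?n = "length A" and ?m = "length B"
    let ?N = "?n + ?m + 2"
    let ?f = "dstep lcs_program A B"
    define T where "T = c * (?n + 1) * (?m + 1) * (nat \<lceil>log 2 (real ?N)\<rceil>) ^ c"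
    obtain T0 where T0: "T0 \<le> 6001 * (?n + 1) * (?m + 1)"
      "\<And>k. T0 \<le> k \<Longrightarrow> (?f ^^ k) init_cfg = (?f ^^ T0) init_cfg"
      "result ((?f ^^ T0) init_cfg) = Some (lcs_len A B)"
      using lcs_program_run by blast
    have run: "run lcs_program A B k = return_pmf ((?f ^^ k) init_cfg)" for k
      using lcs_program_tame tame_not_rand by (intro run_dstep) blast
    \<comment> \<open>The argument is at least 2, so the logarithmic factor can only enlarge
      \<open>T\<close>.\<close>
    have "1 \<le> log 2 (real ?N)" by simp
    then have "1 \<le> nat \<lceil>log 2 (real ?N)\<rceil>" by linarith
    then have "1 \<le> nat \<lceil>log 2 (real ?N)\<rceil> ^ c" by simp
    then have "c * (?n + 1) * (?m + 1) \<le> T" unfolding T_def by simp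
    moreover have "6001 * (?n + 1) * (?m + 1) \<le> c * (?n + 1) * (?m + 1)"
      by (intro mult_le_mono) (simp_all add: c_def)
    ultimately have T: "T0 \<le> T" using T0(1) by linarith
    \<comment> \<open>A common bound for the program constants, the length of \<open>A\<close> and
      all characters.\<close>
    define v where "v = 4 + ?n + ?N ^ d"
    have v: "4 \<le> v" "?n \<le> v" "\<forall>x \<in> set A \<union> set B. x \<le> v"
      using small by (auto simp: v_def intro: order.strict_implies_order trans_le_add2)
    have bound: "regs ((?f ^^ k) init_cfg) r < ?N ^ c" for k r
    proof -
      \<comment> \<open>Registers grow by at most one per step and only up to time
        \<open>T0\<close>, after which the configuration is frozen.\<close>
      have "regs ((?f ^^ k) init_cfg) r \<le> v + T0"
      proof (cases "k \<le> T0")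
        case True
        then show ?thesis using run_bound[OF lcs_program_tame v, of k] by (meson add_left_mono le_trans)
      next
        case False
        then show ?thesis using run_bound[OF lcs_program_tame v, of T0] T0(2)[of k] by simp
      qed
      also have "v + T0 < ?N ^ c"
      proof -
        have 1: "(?n + 1) * (?m + 1) \<le> ?N ^ 2" unfolding power2_eq_square by (rule mult_le_mono) simp_all
        have 2: "T0 \<le> 6001 * ?N ^ 2" using T0(1) mult_le_mono2[OF 1, of 6001] by (simp only: mult.assoc)
        have 3: "4 + ?n \<le> 2 * ?N" by simp
        also have "\<dots> \<le> ?N ^ 2" unfolding power2_eq_square by (rule mult_le_mono) simp_all
        finally have 3: "4 + ?n \<le> ?N ^ 2" .
        have 4: "?N ^ 2 \<le> ?N ^ (d + 2)" "?N ^ d \<le> ?N ^ (d + 2)" by (rule power_increasing; simp)+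
        have "v + T0 \<le> 6003 * ?N ^ (d + 2)" using 2 3 4 unfolding v_def by linarith
        also have "6003 < (2 :: nat) ^ 6003" by (rule less_exp)
        then have "6003 * ?N ^ (d + 2) < 2 ^ 6003 * ?N ^ (d + 2)" by (intro mult_strict_right_mono) simp_all
        also have "(2 :: nat) ^ 6003 \<le> ?N ^ 6003" by (rule power_mono) simp_all
        then have "2 ^ 6003 * ?N ^ (d + 2) \<le> ?N ^ 6003 * ?N ^ (d + 2)" by (rule mult_le_mono1)
        also have "\<dots> = ?N ^ (6003 + (d + 2))" by (simp only: power_add)
        also have "6003 + (d + 2) = c" by (simp add: c_def)
        finally show ?thesis .
      qed
      finally show ?thesis .
    qed
    \<comment> \<open>The run is a point distribution, so the success probability is 1. This also
      covers \<open>n = 0\<close>, where the power of zero is 0 and probability 1 is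
      required.\<close>
    have res: "result ((?f ^^ T) init_cfg) = Some (lcs_len A B)" using T0(2)[OF T] T0(3) by simp
    show "let n = ?n; m = ?m;
          T = c * (n + 1) * (m + 1) * (nat \<lceil>log 2 (real (n + m + 2))\<rceil>) ^ c
      in (\<forall>k \<le> T. \<forall>s \<in> set_pmf (run lcs_program A B k). \<forall>r. regs s r < (n + m + 2) ^ c)
       \<and> (\<forall>s \<in> set_pmf (run lcs_program A B T). result s \<noteq> None)
       \<and> measure_pmf.prob (run lcs_program A B T) {s. result s = Some (lcs_len A B)}
           \<ge> 1 - real n powr (-5)"
      unfolding Let_def T_def[symmetric] run using bound res by (simp add: measure_return)
  qed
qed

end
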